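(* Let $\alpha>-1/2$ and let $\Lambda=\{t_n\}_{n=0}^\infty\subset(0,\infty)$ be a separated sequence. If $\{(t_nx)^{1/2}J_\alpha(t_nx)\}_{n=0}^\infty$ is a Fourier-Bessel frame, then $$D^-(\Lambda)\ \ge\ \frac1\pi .$$
   Context: $J_\alpha$ is the Bessel function of the first kind of order $\alpha$. The system $\{(t_nx)^{1/2}J_\alpha(t_nx)\}_{n=0}^\infty$ is a Fourier-Bessel frame if there exist constants $A,B>0$ such that for every $f\in L^2(0,1)$ $$A\int_0^1|f(x)|^2dx\le\sum_{n=0}^\infty\left|\int_0^1(t_nx)^{1/2}f(x)J_\alpha(t_nx)\,dx\right|^2\le B\int_0^1|f(x)|^2dx.$$ A sequence is separated if the distance between any two distinct points of it exceeds some fixed $d>0$; the $t_n$ are pairwise distinct. For $a\ge0$, $r>0$, let $n_a(r)$ be the number of points of $\Lambda$ in $[a,a+r]$. The lower density is $D^-(\Lambda)=\liminf_{r\to\infty}\ \inf_{a\ge0}\frac{n_a(r)}{r}$. *)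

theory Defs
  imports "HOL-Analysis.Analysis"
begin

text \<open>
  Bessel function of the first kind of real order, on the positive half-line:
  \<open>J\<^sub>\<alpha>(x) = \<Sum>\<^sub>m (-1)^m / (m! \<Gamma>(m+\<alpha>+1)) (x/2)^(2m+\<alpha>)\<close>.
  The entire function \<open>rGamma = 1 / \<Gamma>\<close> gives the right terms also at the poles of \<open>\<Gamma>\<close>.
  The value for \<open>x \<le> 0\<close> depends on conventions of \<open>powr\<close> and has no meaning.
\<close>

definition bessel_J :: "real \<Rightarrow> real \<Rightarrow> real" where
  "bessel_J \<alpha> x =
     (\<Sum>m. (-1) ^ m * rGamma (real m + \<alpha> + 1) / fact m * (x / 2) powr (2 * real m + \<alpha>))"

abbreviation M01 :: "real measure" where
  "M01 \<equiv> lebesgue_on {0<..<1}"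

definition L2_01 :: "(real \<Rightarrow> complex) set" where
  "L2_01 = {f \<in> borel_measurable M01. integrable M01 (\<lambda>x. (cmod (f x))\<^sup>2)}"

definition fourier_bessel_coeff :: "real \<Rightarrow> real \<Rightarrow> (real \<Rightarrow> complex) \<Rightarrow> complex" where
  "fourier_bessel_coeff \<alpha> s f =
     (LINT x|M01. complex_of_real (sqrt (s * x)) * f x * complex_of_real (bessel_J \<alpha> (s * x)))"

text \<open>
  Summability is part of the upper frame bound: \<open>suminf\<close> is unspecified on divergent series.
\<close>

definition fourier_bessel_frame :: "real \<Rightarrow> (nat \<Rightarrow> real) \<Rightarrow> bool" where
  "fourier_bessel_frame \<alpha> t \<longleftrightarrow>
     (\<exists>A>0. \<exists>B>0. \<forall>f\<in>L2_01.
        summable (\<lambda>n. (cmod (fourier_bessel_coeff \<alpha> (t n) f))\<^sup>2) \<and>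
        A * (LINT x|M01. (cmod (f x))\<^sup>2)
          \<le> (\<Sum>n. (cmod (fourier_bessel_coeff \<alpha> (t n) f))\<^sup>2) \<and>
        (\<Sum>n. (cmod (fourier_bessel_coeff \<alpha> (t n) f))\<^sup>2)
          \<le> B * (LINT x|M01. (cmod (f x))\<^sup>2))"

definition separated :: "real set \<Rightarrow> bool" where
  "separated \<Lambda> \<longleftrightarrow> (\<exists>d>0. \<forall>x\<in>\<Lambda>. \<forall>y\<in>\<Lambda>. x \<noteq> y \<longrightarrow> dist x y > d)"

text \<open>
  \<open>card\<close> is the true count only if \<open>\<Lambda>\<close> is finite on bounded intervals,
  which separated sets are.
\<close>

definition n_points :: "real set \<Rightarrow> real \<Rightarrow> real \<Rightarrow> nat" where
  "n_points \<Lambda> a r = card (\<Lambda> \<inter> {a..a + r})"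

definition lower_density :: "real set \<Rightarrow> ereal" where
  "lower_density \<Lambda> = Liminf at_top (\<lambda>r::real. INF a\<in>{0..}. ereal (real (n_points \<Lambda> a r) / r))"

end

(*
  On a fixed interval (eta,1) the kernel sqrt(tx) J_alpha(tx) is, up to O(1/t), a combination of
  e^{itx} and e^{-itx}.  Multiply a polynomial window vanishing at eta and 1 by the exponentials
  e^{ihkx} with |hk| in [a+M, a+r-M] and h = 2 pi/(1-3 eta); these products span a space of
  dimension about (1-3 eta) r/pi, because positive and negative frequencies both count.  By a Schur
  test, the coefficients of its elements f at the t_n outside [a,a+r] and above T carry less than
  half of A |f|^2, with M and T independent of a and r.  If the t_n in [a,a+r] or below T were
  fewer than the dimension, some f <> 0 would have zero coefficients there, against the lower
  frame bound.  Finally eta tends to 0.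
*)

theory Submission
  imports Defs
begin

section \<open>Separated points and the Schur test\<close>

text \<open>Two obstacles shape the construction. The expansion of the kernel has error O(1/(t x)),
  uniform only away from x = 0, hence the cut at \<eta>. A sharp cut-off would have a Fourier
  transform decaying like 1/u, and sums of 1/u over separated points may diverge; a window vanishing
  at both ends gives 1/u^2, whose tails over separated points are small, wherever the points lie.
  The price is that the window has no positive lower bound up to the ends. It is at least \<eta>^2
  on [2\<eta>, 1-\<eta>], and the frequency step is chosen to make the exponentials orthogonal
  exactly there, so that the norm of f controls its coefficients. The two pieces of the kernel
  become small for different reasons. In the oscillating piece all frequencies stay at distance M
  from both t_n and -t_n. The remainder has no decay in the frequency, but it is O(1/t_n), and the
  sum of 1/t_n^2 beyond T is small. Each piece is allotted A/4. The frequencies lost to the margins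
  M and the points below T cost only a constant, which vanishes on division by r.\<close>

lemma exists_nonzero_kernel:
  fixes a :: "'j \<Rightarrow> 'i \<Rightarrow> 'f::field"
  assumes "finite J" "finite I" "card J < card I"
  shows "\<exists>c. (\<exists>i\<in>I. c i \<noteq> 0) \<and> (\<forall>j\<in>J. (\<Sum>i\<in>I. a j i * c i) = 0)"
  using assms
proof (induction J arbitrary: I a rule: finite_induct)
  case empty
  then obtain i where "i \<in> I" by fastforce
  then show ?case by (auto intro!: exI[of _ "\<lambda>_. 1"])
next
  case (insert j J)
  show ?case
  proof (cases "\<forall>i\<in>I. a j i = 0")
    case True
    then show ?thesis using insert.IH[of I a] insert.prems insert.hyps by auto
  next
    case False
    then obtain k where k: "k \<in> I" "a j k \<noteq> 0" by blast
    \<comment> \<open>One step of Gaussian elimination with pivot \<open>a j k\<close>: the unknown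
      \<open>k\<close> is removed from all other equations, and \<open>c'\<close> below recovers it
      from equation \<open>j\<close>.\<close>
    define b where "b j' i = a j' i - a j' k * a j i / a j k" for j' i
    have "card J < card (I - {k})"
      using insert k by (simp add: card_Diff_singleton)
    then obtain c where c: "\<exists>i\<in>I - {k}. c i \<noteq> 0"
        "\<forall>j\<in>J. (\<Sum>i\<in>I - {k}. b j i * c i) = 0"
      using insert.IH[of "I - {k}" b] insert.prems by auto
    define s where "s = (\<Sum>i\<in>I - {k}. a j i * c i)"
    define c' where "c' = c(k := - s / a j k)"
    have split: "(\<Sum>i\<in>I. a j' i * c' i) = (\<Sum>i\<in>I - {k}. a j' i * c i) - a j' k * s / a j k" for j'
    proof -
      have "(\<Sum>i\<in>I. a j' i * c' i) = a j' k * c' k + (\<Sum>i\<in>I - {k}. a j' i * c' i)"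
        using k insert.prems by (simp add: sum.remove)
      also have "(\<Sum>i\<in>I - {k}. a j' i * c' i) = (\<Sum>i\<in>I - {k}. a j' i * c i)"
        by (rule sum.cong) (auto simp: c'_def)
      finally show ?thesis by (simp add: c'_def)
    qed
    have b: "(\<Sum>i\<in>I - {k}. b j' i * c i) = (\<Sum>i\<in>I - {k}. a j' i * c i) - a j' k * s / a j k" for j'
      by (simp add: b_def s_def algebra_simps sum_subtractf sum_distrib_left sum_divide_distrib)
    have "\<exists>i\<in>I. c' i \<noteq> 0" using c(1) by (auto simp: c'_def)
    moreover have "(\<Sum>i\<in>I. a j i * c' i) = 0"
      unfolding split using k by (simp add: s_def)
    moreover have "\<forall>j'\<in>J. (\<Sum>i\<in>I. a j' i * c' i) = 0"
      using c(2) unfolding split b by simp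
    ultimately show ?thesis by blast
  qed
qed

text \<open>Comparison with a telescoping sum:
  \<open>1 / b^2 <= 1 / (b * (b - d)) = (1 / (b - d) - 1 / b) / d\<close> for the least point
  \<open>b\<close>. All other points are at least \<open>b + d\<close>, which is the new
  \<open>m\<close> in the induction hypothesis.\<close>

lemma sum_inverse_squares_separated_pos:
  fixes P :: "real set"
  assumes "finite P" "d > 0" "\<forall>p\<in>P. m \<le> p" "m > d"
    and "\<forall>p\<in>P. \<forall>q\<in>P. p \<noteq> q \<longrightarrow> d \<le> \<bar>p - q\<bar>"
  shows "(\<Sum>p\<in>P. 1 / p\<^sup>2) \<le> 1 / (d * (m - d))"
  using assms(1,3-5)
proof (induction P arbitrary: m rule: finite_linorder_min_induct)
  case empty
  then show ?case using \<open>d > 0\<close> by simp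
next
  case (insert b P)
  have b: "b > d" "b \<ge> m" using insert.prems by auto
  have "p \<ge> b + d" if "p \<in> P" for p
    using insert.prems(3) insert.hyps that by force
  then have "(\<Sum>p\<in>P. 1 / p\<^sup>2) \<le> 1 / (d * (b + d - d))"
    using insert.prems b \<open>d > 0\<close> by (intro insert.IH) auto
  moreover have "b \<notin> P" using insert.hyps by auto
  ultimately have "(\<Sum>p\<in>insert b P. 1 / p\<^sup>2) \<le> 1 / b\<^sup>2 + 1 / (d * b)"
    using insert.hyps by simp
  also have "1 / b\<^sup>2 \<le> 1 / (b * (b - d))"
    using b \<open>d > 0\<close> by (intro divide_left_mono) (auto simp: power2_eq_square)
  also have "1 / (b * (b - d)) + 1 / (d * b) = 1 / (d * (b - d))"
    using b \<open>d > 0\<close> by (simp add: divide_simps)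
  also have "\<dots> \<le> 1 / (d * (m - d))"
    using b \<open>d > 0\<close> insert.prems by (intro divide_left_mono) auto
  finally show ?case by simp
qed

text \<open>One copy of the one-sided bound for each side of \<open>x\<close>. The result depends
  neither on \<open>x\<close> nor on the number of points and tends to 0 as \<open>m\<close> grows;
  the uniformity of the later constants rests on this.\<close>

lemma sum_inverse_squares_separated:
  fixes f :: "'a \<Rightarrow> real"
  assumes "finite S" "d > 0" "\<forall>i\<in>S. m \<le> \<bar>f i - x\<bar>" "m > d"
    and sep: "\<forall>i\<in>S. \<forall>j\<in>S. i \<noteq> j \<longrightarrow> d \<le> \<bar>f i - f j\<bar>"
  shows "(\<Sum>i\<in>S. 1 / (f i - x)\<^sup>2) \<le> 2 / (d * (m - d))"
proof -
  define P where "P = {i\<in>S. f i \<ge> x}"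
  define N where "N = {i\<in>S. f i < x}"
  have inj: "inj_on f S"
    using sep \<open>d > 0\<close> by (intro inj_onI) force
  have "(\<Sum>i\<in>P. 1 / (f i - x)\<^sup>2) = (\<Sum>p\<in>(\<lambda>i. f i - x) ` P. 1 / p\<^sup>2)"
    using inj by (subst sum.reindex) (auto simp: P_def inj_on_def)
  also have "\<dots> \<le> 1 / (d * (m - d))"
    using assms by (intro sum_inverse_squares_separated_pos) (auto simp: P_def)
  finally have 1: "(\<Sum>i\<in>P. 1 / (f i - x)\<^sup>2) \<le> 1 / (d * (m - d))" .
  have "(\<Sum>i\<in>N. 1 / (f i - x)\<^sup>2) = (\<Sum>p\<in>(\<lambda>i. x - f i) ` N. 1 / p\<^sup>2)"
    using inj by (subst sum.reindex) (auto simp: N_def inj_on_def power2_commute)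
  also have "\<dots> \<le> 1 / (d * (m - d))"
    using assms by (intro sum_inverse_squares_separated_pos) (auto simp: N_def abs_minus_commute)
  finally have 2: "(\<Sum>i\<in>N. 1 / (f i - x)\<^sup>2) \<le> 1 / (d * (m - d))" .
  have "S = P \<union> N" "P \<inter> N = {}" by (auto simp: P_def N_def)
  then have "(\<Sum>i\<in>S. 1 / (f i - x)\<^sup>2) = (\<Sum>i\<in>P. 1 / (f i - x)\<^sup>2) + (\<Sum>i\<in>N. 1 / (f i - x)\<^sup>2)"
    using \<open>finite S\<close> by (simp add: sum.union_disjoint)
  with 1 2 show ?thesis by simp
qed

text \<open>Splitting \<open>B\<close> as \<open>sqrt B * sqrt B\<close> before Cauchy-Schwarz
  produces a row sum, and exchanging the two summations produces a column sum; each contributes one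
  factor \<open>R\<close>.\<close>

lemma schur_test:
  fixes b :: "'n \<Rightarrow> 'k \<Rightarrow> complex" and B :: "'n \<Rightarrow> 'k \<Rightarrow> real"
  assumes "finite S" "finite K"
    and bB: "\<And>n k. n \<in> S \<Longrightarrow> k \<in> K \<Longrightarrow> cmod (b n k) \<le> B n k"
    and rows: "\<And>n. n \<in> S \<Longrightarrow> (\<Sum>k\<in>K. B n k) \<le> R"
    and cols: "\<And>k. k \<in> K \<Longrightarrow> (\<Sum>n\<in>S. B n k) \<le> R"
    and "R \<ge> 0"
  shows "(\<Sum>n\<in>S. (cmod (\<Sum>k\<in>K. c k * b n k))\<^sup>2) \<le> R\<^sup>2 * (\<Sum>k\<in>K. (cmod (c k))\<^sup>2)"
proof -
  have row: "(cmod (\<Sum>k\<in>K. c k * b n k))\<^sup>2 \<le> R * (\<Sum>k\<in>K. B n k * (cmod (c k))\<^sup>2)" if n: "n \<in> S" for n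
  proof -
    have B0: "0 \<le> B n k" if "k \<in> K" for k
      using bB[OF n that] norm_ge_zero order_trans by blast
    have "cmod (\<Sum>k\<in>K. c k * b n k) \<le> (\<Sum>k\<in>K. cmod (c k) * B n k)"
      using bB[OF n] by (intro sum_norm_le) (auto simp: norm_mult intro!: mult_left_mono)
    also have "\<dots> = (\<Sum>k\<in>K. sqrt (B n k) * (sqrt (B n k) * cmod (c k)))"
      using B0 by (intro sum.cong) (auto simp flip: mult.assoc)
    finally have "(cmod (\<Sum>k\<in>K. c k * b n k))\<^sup>2 \<le> (\<Sum>k\<in>K. sqrt (B n k) * (sqrt (B n k) * cmod (c k)))\<^sup>2"
      by (intro power_mono) auto
    also have "\<dots> \<le> (\<Sum>k\<in>K. (sqrt (B n k))\<^sup>2) * (\<Sum>k\<in>K. (sqrt (B n k) * cmod (c k))\<^sup>2)"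
      by (rule Cauchy_Schwarz_ineq_sum)
    also have "\<dots> = (\<Sum>k\<in>K. B n k) * (\<Sum>k\<in>K. B n k * (cmod (c k))\<^sup>2)"
      using B0 by (simp add: power_mult_distrib)
    also have "\<dots> \<le> R * (\<Sum>k\<in>K. B n k * (cmod (c k))\<^sup>2)"
      using B0 rows[OF n] by (intro mult_right_mono sum_nonneg) auto
    finally show ?thesis .
  qed
  have "(\<Sum>n\<in>S. (cmod (\<Sum>k\<in>K. c k * b n k))\<^sup>2) \<le> (\<Sum>n\<in>S. R * (\<Sum>k\<in>K. B n k * (cmod (c k))\<^sup>2))"
    by (intro sum_mono row)
  also have "\<dots> = R * (\<Sum>k\<in>K. (\<Sum>n\<in>S. B n k) * (cmod (c k))\<^sup>2)"
    by (subst sum_distrib_left[symmetric], subst sum.swap) (simp add: sum_distrib_right)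
  also have "\<dots> \<le> R * (\<Sum>k\<in>K. R * (cmod (c k))\<^sup>2)"
    using \<open>R \<ge> 0\<close> cols by (intro mult_left_mono sum_mono mult_right_mono) auto
  also have "\<dots> = R\<^sup>2 * (\<Sum>k\<in>K. (cmod (c k))\<^sup>2)"
    by (simp add: sum_distrib_left power2_eq_square mult.assoc)
  finally show ?thesis .
qed

section \<open>Counting separated points and lattice frequencies\<close>

lemma finite_separated_bounded:
  fixes f :: "nat \<Rightarrow> real"
  assumes "d > 0" and sep: "\<And>i j. i \<noteq> j \<Longrightarrow> d \<le> \<bar>f i - f j\<bar>"
  shows "finite {n. f n \<in> {a..b}}"
proof -
  \<comment> \<open>Pigeonhole: two points in the same cell of length \<open>d\<close> would be
    closer than \<open>d\<close>.\<close>
  have "inj_on (\<lambda>n. \<lfloor>f n / d\<rfloor>) {n. f n \<in> {a..b}}"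
  proof (rule inj_onI, rule ccontr)
    fix i j assume eq: "\<lfloor>f i / d\<rfloor> = \<lfloor>f j / d\<rfloor>" and "i \<noteq> j"
    have "\<bar>f i / d - f j / d\<bar> < 1"
      using eq by linarith
    also have "\<bar>f i / d - f j / d\<bar> = \<bar>f i - f j\<bar> / d"
      using \<open>d > 0\<close> by (simp flip: diff_divide_distrib)
    finally have "\<bar>f i - f j\<bar> < d" using \<open>d > 0\<close> by simp
    with sep[OF \<open>i \<noteq> j\<close>] show False by simp
  qed
  moreover have "(\<lambda>n. \<lfloor>f n / d\<rfloor>) ` {n. f n \<in> {a..b}} \<subseteq> {\<lfloor>a / d\<rfloor>..\<lfloor>b / d\<rfloor>}"
    using \<open>d > 0\<close> by (auto intro!: floor_mono divide_right_mono)
  ultimately show ?thesis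
    using finite_atLeastAtMost_int inj_on_finite by blast
qed

text \<open>Since \<open>x > 0\<close> excludes \<open>k = 0\<close>, the positive solutions and
  their mirror images are disjoint, whence the factor 2. It is this factor that turns the spacing
  \<open>h\<close>, about 2 pi, into the density 1/pi.\<close>

lemma card_symmetric_int_window:
  fixes h x y :: real
  assumes "h > 0" "0 < x"
  defines "K \<equiv> {k::int. x \<le> h * \<bar>real_of_int k\<bar> \<and> h * \<bar>real_of_int k\<bar> \<le> y}"
  shows "finite K" and "real (card K) \<ge> 2 * ((y - x) / h - 1)"
proof -
  define P where "P = {\<lceil>x / h\<rceil>..\<lfloor>y / h\<rfloor>}"
  have mem: "k \<in> P \<longleftrightarrow> x \<le> h * of_int k \<and> h * of_int k \<le> y" for k
    using \<open>h > 0\<close> by (auto simp: P_def ceiling_le_iff le_floor_iff field_simps)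
  have pos: "k > 0" if "k \<in> P" for k
  proof -
    have "0 < h * of_int k" using that mem assms by force
    then show ?thesis using \<open>h > 0\<close> by (simp add: zero_less_mult_iff)
  qed
  have K: "K = P \<union> uminus ` P"
  proof (intro equalityI subsetI)
    fix k assume "k \<in> K"
    then have "\<bar>k\<bar> \<in> P" by (simp add: K_def mem)
    then show "k \<in> P \<union> uminus ` P"
      by (cases "k \<ge> 0") (auto intro: rev_image_eqI)
  next
    fix k assume "k \<in> P \<union> uminus ` P"
    then show "k \<in> K" using pos by (force simp: K_def mem)
  qed
  have fin: "finite P" by (simp add: P_def)
  with K show "finite K" by simp
  have "P \<inter> uminus ` P = {}"
    using pos by (fastforce dest: pos)
  then have "card K = 2 * card P"
    unfolding K using fin by (simp add: card_Un_disjoint card_image)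
  moreover have "(y - x) / h - 1 \<le> real (card P)"
    unfolding P_def by (simp add: diff_divide_distrib) linarith
  then have "2 * ((y - x) / h - 1) \<le> 2 * real (card P)"
    by (rule mult_left_mono) simp
  ultimately show "real (card K) \<ge> 2 * ((y - x) / h - 1)" by simp
qed

section \<open>Asymptotics of the Bessel function\<close>

text \<open>\<open>g + K / z\<close> is nonincreasing and \<open>g - K / z\<close> is nondecreasing,
  so the two squeeze a common value. This gives limit and rate at once, without integrating
  \<open>g'\<close>.\<close>

lemma converges_of_deriv_inverse_square:
  fixes g g' :: "real \<Rightarrow> real"
  assumes deriv: "\<And>z. z \<ge> 1 \<Longrightarrow> (g has_real_derivative g' z) (at z)"
    and bound: "\<And>z. z \<ge> 1 \<Longrightarrow> \<bar>g' z\<bar> \<le> K / z\<^sup>2"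
  shows "\<exists>L. \<forall>z\<ge>1. \<bar>g z - L\<bar> \<le> K / z"
proof -
  have dec: "g y + K / y \<le> g x + K / x" if "1 \<le> x" "x \<le> y" for x y
  proof (rule DERIV_nonpos_imp_nonincreasing[OF that(2)])
    fix z assume "x \<le> z" "z \<le> y"
    then have z: "z \<ge> 1" using that by simp
    have "((\<lambda>z. g z + K / z) has_real_derivative g' z - K / z\<^sup>2) (at z)"
      using z deriv[OF z] by (auto intro!: derivative_eq_intros simp: power2_eq_square)
    then show "\<exists>D. ((\<lambda>z. g z + K / z) has_real_derivative D) (at z) \<and> D \<le> 0"
      using bound[OF z] by (intro exI conjI) auto
  qed
  have inc: "g x - K / x \<le> g y - K / y" if "1 \<le> x" "x \<le> y" for x y
  proof (rule DERIV_nonneg_imp_nondecreasing[OF that(2)])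
    fix z assume "x \<le> z" "z \<le> y"
    then have z: "z \<ge> 1" using that by simp
    have "((\<lambda>z. g z - K / z) has_real_derivative g' z + K / z\<^sup>2) (at z)"
      using z deriv[OF z] by (auto intro!: derivative_eq_intros simp: power2_eq_square)
    then show "\<exists>D. ((\<lambda>z. g z - K / z) has_real_derivative D) (at z) \<and> D \<ge> 0"
      using bound[OF z] by (intro exI conjI) auto
  qed
  have K0: "K \<ge> 0" using bound[of 1] by simp
  have le: "g x - K / x \<le> g y + K / y" if "1 \<le> x" "1 \<le> y" for x y
  proof -
    have "g x - K / x \<le> g (max x y) - K / max x y" by (rule inc) (use that in auto)
    also have "\<dots> \<le> g (max x y) + K / max x y" using K0 that by simp
    also have "\<dots> \<le> g y + K / y" by (rule dec) (use that in auto)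
    finally show ?thesis .
  qed
  define L where "L = (SUP x\<in>{1..}. g x - K / x)"
  have "bdd_above ((\<lambda>x. g x - K / x) ` {1..})"
    using le[of _ 1] by (auto simp: bdd_above_def)
  then have "g z - K / z \<le> L" if "z \<ge> 1" for z
    unfolding L_def using that by (intro cSUP_upper[where f = "\<lambda>x. g x - K / x"]) auto
  moreover have "L \<le> g z + K / z" if "z \<ge> 1" for z
    unfolding L_def by (rule cSUP_least) (use that le in auto)
  ultimately show ?thesis
    by (intro exI[of _ L]) (force simp: abs_le_iff)
qed

text \<open>A Gronwall argument for the energy \<open>u^2 + u'^2\<close>: its derivative is
  \<open>2 * c * u * u' / z^2\<close>, at most \<open>\<bar>c\<bar> / z^2\<close> times the energy.
  The factor \<open>exp (\<bar>c\<bar> / z)\<close> compensates this growth, so that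
  \<open>H\<close> decreases, and it is at least 1.\<close>

lemma perturbed_oscillator_bounded:
  fixes u u' :: "real \<Rightarrow> real"
  assumes du: "\<And>z. z > 0 \<Longrightarrow> (u has_real_derivative u' z) (at z)"
    and du': "\<And>z. z > 0 \<Longrightarrow> (u' has_real_derivative (c / z\<^sup>2 - 1) * u z) (at z)"
  shows "\<exists>D. \<forall>z\<ge>1. \<bar>u z\<bar> \<le> D"
proof -
  define H where "H z = ((u z)\<^sup>2 + (u' z)\<^sup>2) * exp (\<bar>c\<bar> / z)" for z
  have dec: "H z \<le> H 1" if "z \<ge> 1" for z
  proof (rule DERIV_nonpos_imp_nonincreasing[OF that])
    fix x :: real assume x: "1 \<le> x" "x \<le> z"
    define D where "D = (2 * c * (u x * u' x) - \<bar>c\<bar> * ((u x)\<^sup>2 + (u' x)\<^sup>2)) / x\<^sup>2 * exp (\<bar>c\<bar> / x)"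
    have "(H has_real_derivative D) (at x)"
      unfolding H_def[abs_def] D_def using x
      by (auto intro!: derivative_eq_intros du du' simp: field_simps power2_eq_square)
    moreover have "D \<le> 0"
    proof -
      have "2 * c * (u x * u' x) \<le> \<bar>c\<bar> * (2 * \<bar>u x * u' x\<bar>)"
        by (metis abs_ge_self abs_mult abs_numeral mult.assoc mult.left_commute)
      also have "\<dots> \<le> \<bar>c\<bar> * ((u x)\<^sup>2 + (u' x)\<^sup>2)"
        using sum_squares_bound[of "\<bar>u x\<bar>" "\<bar>u' x\<bar>"]
        by (intro mult_left_mono) (auto simp: abs_mult mult.assoc)
      finally show ?thesis
        by (auto simp: D_def mult_nonpos_nonneg divide_nonpos_nonneg)
    qed
    ultimately show "\<exists>D. (H has_real_derivative D) (at x) \<and> D \<le> 0" by blast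
  qed
  have "\<bar>u z\<bar> \<le> sqrt (H 1)" if "z \<ge> 1" for z
  proof -
    have "(u z)\<^sup>2 \<le> ((u z)\<^sup>2 + (u' z)\<^sup>2) * 1" by simp
    also have "\<dots> \<le> H z" unfolding H_def using that by (intro mult_left_mono) auto
    also have "\<dots> \<le> H 1" by (rule dec[OF that])
    finally show ?thesis by (metis real_sqrt_abs real_sqrt_le_iff)
  qed
  then show ?thesis by blast
qed

text \<open>Variation of parameters: with \<open>A = u cos - u' sin\<close> and \<open>B = u sin + u' cos\<close> one has
  \<open>u = A cos + B sin\<close>, and \<open>A'\<close>, \<open>B'\<close> are \<open>O(1/z\<^sup>2)\<close>.\<close>

lemma perturbed_oscillator_asymptotics:
  fixes u u' :: "real \<Rightarrow> real"
  assumes du: "\<And>z. z > 0 \<Longrightarrow> (u has_real_derivative u' z) (at z)"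
    and du': "\<And>z. z > 0 \<Longrightarrow> (u' has_real_derivative (c / z\<^sup>2 - 1) * u z) (at z)"
  shows "\<exists>a b C. \<forall>z\<ge>1. \<bar>u z - (a * cos z + b * sin z)\<bar> \<le> C / z"
proof -
  obtain D where D: "\<And>z. z \<ge> 1 \<Longrightarrow> \<bar>u z\<bar> \<le> D"
    using perturbed_oscillator_bounded[OF du du'] by blast
  have bound: "\<bar>c / z\<^sup>2 * u z * s\<bar> \<le> \<bar>c\<bar> * D / z\<^sup>2" if "z \<ge> 1" "\<bar>s\<bar> \<le> 1" for z s
  proof -
    have "\<bar>c / z\<^sup>2 * u z * s\<bar> = \<bar>c\<bar> / z\<^sup>2 * (\<bar>u z\<bar> * \<bar>s\<bar>)" by (simp add: abs_mult)
    also have "\<dots> \<le> \<bar>c\<bar> / z\<^sup>2 * (D * 1)"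
      using D[OF that(1)] that by (intro mult_left_mono mult_mono) auto
    finally show ?thesis by simp
  qed
  define A where "A z = u z * cos z - u' z * sin z" for z
  define B where "B z = u z * sin z + u' z * cos z" for z
  have "\<exists>a. \<forall>z\<ge>1. \<bar>A z - a\<bar> \<le> \<bar>c\<bar> * D / z"
  proof (rule converges_of_deriv_inverse_square)
    fix z :: real assume "z \<ge> 1"
    then show "(A has_real_derivative c / z\<^sup>2 * u z * (- sin z)) (at z)"
      unfolding A_def[abs_def] by (auto intro!: derivative_eq_intros du du' simp: field_simps)
  qed (rule bound; simp)
  then obtain a where a: "\<And>z. z \<ge> 1 \<Longrightarrow> \<bar>A z - a\<bar> \<le> \<bar>c\<bar> * D / z" by blast
  have "\<exists>b. \<forall>z\<ge>1. \<bar>B z - b\<bar> \<le> \<bar>c\<bar> * D / z"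
  proof (rule converges_of_deriv_inverse_square)
    fix z :: real assume "z \<ge> 1"
    then show "(B has_real_derivative c / z\<^sup>2 * u z * cos z) (at z)"
      unfolding B_def[abs_def] by (auto intro!: derivative_eq_intros du du' simp: field_simps)
  qed (rule bound; simp)
  then obtain b where b: "\<And>z. z \<ge> 1 \<Longrightarrow> \<bar>B z - b\<bar> \<le> \<bar>c\<bar> * D / z" by blast
  have "\<bar>u z - (a * cos z + b * sin z)\<bar> \<le> 2 * \<bar>c\<bar> * D / z" if z: "z \<ge> 1" for z
  proof -
    have "A z * cos z + B z * sin z = u z * ((sin z)\<^sup>2 + (cos z)\<^sup>2)"
      unfolding A_def B_def by algebra
    then have "u z - (a * cos z + b * sin z) = (A z - a) * cos z + (B z - b) * sin z"
      by (simp add: algebra_simps)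
    also have "\<bar>\<dots>\<bar> \<le> \<bar>A z - a\<bar> * 1 + \<bar>B z - b\<bar> * 1"
      by (rule order_trans[OF abs_triangle_ineq], unfold abs_mult, intro add_mono mult_left_mono) auto
    also have "\<dots> \<le> \<bar>c\<bar> * D / z + \<bar>c\<bar> * D / z"
      unfolding mult_1_right by (rule add_mono[OF a[OF z] b[OF z]])
    also have "\<dots> = 2 * \<bar>c\<bar> * D / z" by simp
    finally show ?thesis .
  qed
  then show ?thesis by blast
qed

text \<open>Bessel's equation in Liouville form: the factor \<open>sqrt z\<close> removes the
  first-order term and leaves a perturbed oscillator. The equation is read off from the entire
  series \<open>g\<close> in the variable \<open>z^2 / 4\<close>, in which the non-integral power of
  \<open>z\<close> is split off.\<close>

lemma bessel_J_ODE_solution: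
  fixes \<alpha> :: real
  obtains u' where
    "\<And>z. z > 0 \<Longrightarrow> ((\<lambda>z. sqrt z * bessel_J \<alpha> z) has_real_derivative u' z) (at z)"
    "\<And>z. z > 0 \<Longrightarrow> (u' has_real_derivative
        ((\<alpha>\<^sup>2 - 1/4) / z\<^sup>2 - 1) * (sqrt z * bessel_J \<alpha> z)) (at z)"
proof -
  define b where "b m = (-1) ^ m * rGamma (real m + \<alpha> + 1) / fact m" for m
  \<comment> \<open>Written without division, so that no separate case
    \<open>real m + \<alpha> + 1 = 0\<close> arises.\<close>
  have rec: "(real m + 1) * (real m + \<alpha> + 1) * b (Suc m) = - b m" for m
  proof -
    have "rGamma (real m + \<alpha> + 1) = (real m + \<alpha> + 1) * rGamma (real (Suc m) + \<alpha> + 1)"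
      using rGamma_plus1[of "real m + \<alpha> + 1"] by (simp add: add_ac)
    moreover have "fact (Suc m) = (real m + 1) * fact m" by simp
    moreover have "real m + 1 \<noteq> 0" by linarith
    ultimately show ?thesis
      unfolding b_def by (simp del: of_nat_Suc fact_Suc)
  qed
  have summ: "summable (\<lambda>m. b m * y ^ m)" for y
  \<comment> \<open>The threshold serves two ends: \<open>n >= \<bar>\<alpha>\<bar>\<close> makes
    the factor \<open>\<bar>real n + \<alpha> + 1\<bar>\<close> at least 1, and
    \<open>n >= 2 * \<bar>y\<bar>\<close> then gives the ratio 1/2.\<close>
  proof (rule summable_ratio_test[of "1/2" "nat \<lceil>max (2 * \<bar>y\<bar>) (\<bar>\<alpha>\<bar>)\<rceil>"])
    fix n assume "n \<ge> nat \<lceil>max (2 * \<bar>y\<bar>) \<bar>\<alpha>\<bar>\<rceil>"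
    then have n: "real n \<ge> 2 * \<bar>y\<bar>" "real n \<ge> \<bar>\<alpha>\<bar>" by linarith+
    have "\<bar>b n\<bar> = (real n + 1) * \<bar>real n + \<alpha> + 1\<bar> * \<bar>b (Suc n)\<bar>"
      using arg_cong[OF rec[of n], of abs] by (simp add: abs_mult)
    also have "\<dots> \<ge> (real n + 1) * 1 * \<bar>b (Suc n)\<bar>"
      using n by (intro mult_mono) auto
    finally have "2 * \<bar>y\<bar> * \<bar>b (Suc n)\<bar> \<le> \<bar>b n\<bar>"
      using n mult_right_mono[of "2 * \<bar>y\<bar>" "real n + 1" "\<bar>b (Suc n)\<bar>"] by simp
    from mult_right_mono[OF this, of "\<bar>y\<bar> ^ n"]
    show "norm (b (Suc n) * y ^ Suc n) \<le> 1/2 * norm (b n * y ^ n)"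
      by (simp add: abs_mult power_abs mult_ac)
  qed simp
  define g where "g y = (\<Sum>m. b m * y ^ m)" for y
  define g1 where "g1 y = (\<Sum>m. diffs b m * y ^ m)" for y
  define g2 where "g2 y = (\<Sum>m. diffs (diffs b) m * y ^ m)" for y
  have summ1: "summable (\<lambda>m. diffs b m * y ^ m)" for y
    by (rule termdiff_converges_all[OF summ])
  have summ2: "summable (\<lambda>m. diffs (diffs b) m * y ^ m)" for y
    by (rule termdiff_converges_all[OF summ1])
  have dg: "(g has_real_derivative g1 y) (at y)" for y
    unfolding g_def[abs_def] g1_def by (rule termdiffs_strong_converges_everywhere[OF summ])
  have dg1: "(g1 has_real_derivative g2 y) (at y)" for y
    unfolding g1_def[abs_def] g2_def by (rule termdiffs_strong_converges_everywhere[OF summ1])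
  \<comment> \<open>Comparison of coefficients: that of \<open>y ^ m\<close> on the left is
    \<open>(m + 1) * (m + \<alpha> + 1) * b (Suc m) + b m\<close>, which is 0 by \<open>rec\<close>.
    The index shift for \<open>y * g2 y\<close> adds only a zero term at
    \<open>m = 0\<close>.\<close>
  have ode: "y * g2 y + (\<alpha> + 1) * g1 y + g y = 0" for y
  proof -
    have "(\<lambda>m. diffs (diffs b) m * y ^ m * y) sums (g2 y * y)"
      unfolding g2_def by (intro sums_mult2 summable_sums summ2)
    then have "(\<lambda>m. real (Suc m) * diffs b (Suc m) * y ^ Suc m) sums (g2 y * y)"
      by (simp add: diffs_def mult_ac)
    then have "(\<lambda>m. real m * diffs b m * y ^ m) sums (g2 y * y)"
      by (subst (asm) sums_Suc_iff) simp
    moreover have "(\<lambda>m. (\<alpha> + 1) * (diffs b m * y ^ m)) sums ((\<alpha> + 1) * g1 y)"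
      unfolding g1_def by (intro sums_mult summable_sums summ1)
    moreover have "(\<lambda>m. b m * y ^ m) sums g y"
      unfolding g_def by (intro summable_sums summ)
    ultimately have "(\<lambda>m. real m * diffs b m * y ^ m + (\<alpha> + 1) * (diffs b m * y ^ m) + b m * y ^ m)
        sums (g2 y * y + (\<alpha> + 1) * g1 y + g y)"
      by (intro sums_add)
    moreover have "real m * diffs b m * y ^ m + (\<alpha> + 1) * (diffs b m * y ^ m) + b m * y ^ m = 0" for m
    proof -
      have "real m * diffs b m * y ^ m + (\<alpha> + 1) * (diffs b m * y ^ m) + b m * y ^ m
          = ((real m + 1) * (real m + \<alpha> + 1) * b (Suc m) + b m) * y ^ m"
        by (simp add: diffs_def algebra_simps)
      then show ?thesis by (simp add: rec)
    qed
    ultimately have "(\<lambda>m. 0) sums (g2 y * y + (\<alpha> + 1) * g1 y + g y)" by simp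
    then show ?thesis using sums_unique2[OF sums_zero] by (metis mult.commute)
  qed
  \<comment> \<open>The exponent of \<open>z\<close> in \<open>sqrt z * z powr \<alpha>\<close>. The
    constant of the oscillator arises as
    \<open>\<beta> * (\<beta> - 1) = \<alpha>^2 - 1/4\<close>.\<close>
  define \<beta> where "\<beta> = \<alpha> + 1/2"
  define v where "v z = 2 powr (-\<alpha>) * z powr \<beta> * g (z\<^sup>2 / 4)" for z
  define v' where "v' z = 2 powr (-\<alpha>) *
      (\<beta> * z powr (\<beta> - 1) * g (z\<^sup>2 / 4) + z powr \<beta> * (z / 2) * g1 (z\<^sup>2 / 4))" for z
  have v: "sqrt z * bessel_J \<alpha> z = v z" if "z > 0" for z
  proof -
    have "bessel_J \<alpha> z = (\<Sum>m. (z / 2) powr \<alpha> * (b m * (z\<^sup>2 / 4) ^ m))"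
      unfolding bessel_J_def
    proof (intro suminf_cong)
      fix m
      have "(z / 2) powr (2 * real m + \<alpha>) = (z / 2) powr \<alpha> * (z\<^sup>2 / 4) ^ m"
        using that powr_realpow[of "z / 2" "2 * m"]
        by (simp add: powr_add power_mult power_divide)
      then show "(-1) ^ m * rGamma (real m + \<alpha> + 1) / fact m * (z / 2) powr (2 * real m + \<alpha>)
          = (z / 2) powr \<alpha> * (b m * (z\<^sup>2 / 4) ^ m)"
        by (simp add: b_def)
    qed
    also have "\<dots> = (z / 2) powr \<alpha> * g (z\<^sup>2 / 4)"
      unfolding g_def by (intro suminf_mult summ)
    finally have J: "bessel_J \<alpha> z = (z / 2) powr \<alpha> * g (z\<^sup>2 / 4)" .
    have "(z / 2) powr \<alpha> = 2 powr (-\<alpha>) * z powr \<alpha>"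
      using that by (simp add: powr_divide powr_minus_divide)
    moreover have "z powr \<beta> = z powr \<alpha> * sqrt z"
      using that unfolding \<beta>_def powr_add by (simp add: powr_half_sqrt)
    ultimately show ?thesis by (simp only: J v_def mult_ac)
  qed
  have dv: "(v has_real_derivative v' z) (at z)" if "z > 0" for z
    unfolding v_def[abs_def] v'_def using that
    by (auto intro!: derivative_eq_intros DERIV_chain2[OF dg] simp: algebra_simps)
  have dv': "(v' has_real_derivative ((\<alpha>\<^sup>2 - 1/4) / z\<^sup>2 - 1) * v z) (at z)" if "z > 0" for z
  proof -
    define y where "y = z\<^sup>2 / 4"
    define P where "P = z powr \<beta>"
    have p1: "z powr (\<beta> - 1) = P / z"
      using that by (simp add: P_def powr_diff)
    have p2: "z powr (\<beta> - 2) = P / z\<^sup>2"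
      using that by (simp add: P_def powr_diff powr_numeral)
    have "(v' has_real_derivative 2 powr (-\<alpha>) *
       (\<beta> * ((\<beta> - 1) * z powr (\<beta> - 2) * g y + z powr (\<beta> - 1) * (g1 y * (z / 2)))
        + ((\<beta> * z powr (\<beta> - 1) * (z / 2) + z powr \<beta> * (1 / 2)) * g1 y
           + z powr \<beta> * (z / 2) * (g2 y * (z / 2))))) (at z)"
      unfolding v'_def[abs_def] y_def using that
      by (auto intro!: derivative_eq_intros DERIV_chain2[OF dg] DERIV_chain2[OF dg1] simp: field_simps)
    also have "2 powr (-\<alpha>) *
       (\<beta> * ((\<beta> - 1) * z powr (\<beta> - 2) * g y + z powr (\<beta> - 1) * (g1 y * (z / 2)))
        + ((\<beta> * z powr (\<beta> - 1) * (z / 2) + z powr \<beta> * (1 / 2)) * g1 y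
           + z powr \<beta> * (z / 2) * (g2 y * (z / 2))))
       = 2 powr (-\<alpha>) * z powr \<beta> * (\<beta> * (\<beta> - 1) / z\<^sup>2 * g y + (y * g2 y + (\<beta> + 1/2) * g1 y))"
      unfolding p1 p2 P_def[symmetric] using that
      by (simp add: y_def power2_eq_square) (simp add: algebra_simps)
    also have "y * g2 y + (\<beta> + 1/2) * g1 y = - g y"
      using ode[of y] by (simp add: \<beta>_def algebra_simps)
    also have "\<beta> * (\<beta> - 1) = \<alpha>\<^sup>2 - 1/4"
      by (simp add: \<beta>_def power2_eq_square algebra_simps)
    finally show ?thesis by (simp add: v_def y_def algebra_simps)
  qed
  show ?thesis
  proof (rule that[of v'])
    fix z :: real assume z: "z > 0"
    show "((\<lambda>z. sqrt z * bessel_J \<alpha> z) has_real_derivative v' z) (at z)"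
      by (rule has_field_derivative_transform_within_open[OF dv[OF z], of "{0<..}"])
        (use z v in auto)
    show "(v' has_real_derivative ((\<alpha>\<^sup>2 - 1/4) / z\<^sup>2 - 1) * (sqrt z * bessel_J \<alpha> z)) (at z)"
      using dv'[OF z] v[OF z] by simp
  qed
qed

lemma sqrt_bessel_J_continuous: "continuous_on {0<..} (\<lambda>z. sqrt z * bessel_J \<alpha> z)"
  by (rule bessel_J_ODE_solution[of \<alpha>])
    (meson DERIV_isCont continuous_at_imp_continuous_on greaterThan_iff)

text \<open>The classical amplitude and phase are not computed: later only
  \<open>cmod p + cmod q\<close> matters, in the choice of the margin \<open>M\<close>.\<close>

lemma sqrt_bessel_J_asymptotics:
  obtains p q :: complex and C :: real where
    "\<And>z. z \<ge> 1 \<Longrightarrow>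
      cmod (complex_of_real (sqrt z * bessel_J \<alpha> z) - (p * cis z + q * cis (- z))) \<le> C / z"
proof -
  obtain u' where
    "\<And>z. z > 0 \<Longrightarrow> ((\<lambda>z. sqrt z * bessel_J \<alpha> z) has_real_derivative u' z) (at z)"
    "\<And>z. z > 0 \<Longrightarrow> (u' has_real_derivative
        ((\<alpha>\<^sup>2 - 1/4) / z\<^sup>2 - 1) * (sqrt z * bessel_J \<alpha> z)) (at z)"
    by (rule bessel_J_ODE_solution[of \<alpha>]) blast
  from perturbed_oscillator_asymptotics[OF this] obtain a b C where
    abC: "\<And>z. z \<ge> 1 \<Longrightarrow> \<bar>sqrt z * bessel_J \<alpha> z - (a * cos z + b * sin z)\<bar> \<le> C / z"
    by blast
  \<comment> \<open>With this \<open>p\<close>, twice the real part of \<open>p * cis z\<close> is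
    \<open>a * cos z + b * sin z\<close>; hence \<open>q\<close> is \<open>cnj p\<close>.\<close>
  define p where "p = Complex (a / 2) (- b / 2)"
  have "p * cis z + cnj p * cis (- z) = complex_of_real (a * cos z + b * sin z)" for z
    by (simp add: complex_eq_iff p_def)
  then have "cmod (complex_of_real (sqrt z * bessel_J \<alpha> z) - (p * cis z + cnj p * cis (- z))) \<le> C / z"
    if "z \<ge> 1" for z
    using abC[OF that] by (simp only: flip: of_real_diff) (simp only: norm_of_real)
  then show ?thesis by (rule that)
qed

section \<open>Windowed exponentials\<close>

text \<open>Passage from the Lebesgue integral over (0,1) to the gauge integral over [\<eta>,1],
  where antiderivatives are at hand. Where \<open>g\<close> is nonzero, the two domains differ at
  most in the points 0 and 1.\<close>

lemma integral_M01_eq: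
  fixes g :: "real \<Rightarrow> 'a::euclidean_space"
  assumes "0 \<le> \<eta>" "\<eta> \<le> 1" "continuous_on {\<eta>..1} g" "\<And>x. x < \<eta> \<Longrightarrow> g x = 0"
  shows "integrable M01 g" and "(LINT x|M01. g x) = integral {\<eta>..1} g"
proof -
  have "{x \<in> {\<eta>..1} - {0<..<1}. g x \<noteq> 0} \<subseteq> {0, 1}" "{x \<in> {0<..<1} - {\<eta>..1}. g x \<noteq> 0} = {}"
    using assms(1,4) by force+
  then have null: "negligible {x \<in> {\<eta>..1} - {0<..<1}. g x \<noteq> 0}"
      "negligible {x \<in> {0<..<1} - {\<eta>..1}. g x \<noteq> 0}"
    by (metis finite.emptyI finite.insertI negligible_finite negligible_subset, metis negligible_empty)
  have "g absolutely_integrable_on {\<eta>..1}"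
    by (rule absolutely_integrable_continuous_real[OF assms(3)])
  then have "g absolutely_integrable_on {0<..<1}"
    using absolutely_integrable_spike_set_eq[OF null] by blast
  then show int: "integrable M01 g"
    by (rule absolutely_integrable_imp_integrable) simp
  show "(LINT x|M01. g x) = integral {\<eta>..1} g"
    using lebesgue_integral_eq_integral[OF int] integral_spike_set[OF null] by simp
qed

lemma has_vector_derivative_cis:
  "((\<lambda>x. cis (u * x)) has_vector_derivative (\<i> * of_real u * cis (u * x))) (at x within S)"
  unfolding has_vector_derivative_complex_iff
  by (auto intro!: derivative_eq_intros)

text \<open>Repeated integration by parts: the polynomial vanishes at both ends, so the boundary
  term of order \<open>1 / u\<close> drops out. Each end contributes at most
  \<open>1 / u^2 + 2 / \<bar>u\<bar> ^ 3 <= 3 / u^2\<close>.\<close>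

lemma norm_window_fourier_le:
  fixes \<eta> u :: real
  assumes "0 \<le> \<eta>" "\<eta> \<le> 1" "\<bar>u\<bar> \<ge> 1"
  shows "cmod (integral {\<eta>..1} (\<lambda>x. complex_of_real ((x - \<eta>) * (1 - x)) * cis (u * x))) \<le> 6 / u\<^sup>2"
proof -
  define v where "v = \<i> * complex_of_real u"
  have v0: "v \<noteq> 0" using assms by (auto simp: v_def)
  have v_norm: "cmod v = \<bar>u\<bar>" by (simp add: v_def norm_mult)
  \<comment> \<open>For a quadratic w, an antiderivative of w(x) e^(vx) is e^(vx) (w/v - w'/v^2 +
    w''/v^3); here w' = 1 + \<eta> - 2x and w'' = -2.\<close>
  define G where "G x = cis (u * x) * (complex_of_real ((x - \<eta>) * (1 - x)) / v
      - complex_of_real (1 + \<eta> - 2 * x) / v ^ 2 - 2 / v ^ 3)" for x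
  have "((\<lambda>x. complex_of_real ((x - \<eta>) * (1 - x)) * cis (u * x)) has_integral (G 1 - G \<eta>)) {\<eta>..1}"
  proof (rule fundamental_theorem_of_calculus)
    fix x
    have "(G has_vector_derivative
       (cis (u * x) * (complex_of_real (1 + \<eta> - 2 * x) / v - complex_of_real (-2) / v ^ 2)
        + v * cis (u * x) * (complex_of_real ((x - \<eta>) * (1 - x)) / v
          - complex_of_real (1 + \<eta> - 2 * x) / v ^ 2 - 2 / v ^ 3))) (at x within {\<eta>..1})"
      unfolding G_def[abs_def] v_def
      by (rule derivative_eq_intros has_vector_derivative_cis refl | simp add: algebra_simps)+
    also have "(cis (u * x) * (complex_of_real (1 + \<eta> - 2 * x) / v - complex_of_real (-2) / v ^ 2)
        + v * cis (u * x) * (complex_of_real ((x - \<eta>) * (1 - x)) / v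
          - complex_of_real (1 + \<eta> - 2 * x) / v ^ 2 - 2 / v ^ 3))
        = complex_of_real ((x - \<eta>) * (1 - x)) * cis (u * x)"
      using v0 by (simp add: field_simps power2_eq_square power3_eq_cube)
    finally show "(G has_vector_derivative complex_of_real ((x - \<eta>) * (1 - x)) * cis (u * x))
        (at x within {\<eta>..1})" .
  qed (use assms in auto)
  then have "cmod (integral {\<eta>..1} (\<lambda>x. complex_of_real ((x - \<eta>) * (1 - x)) * cis (u * x))) = cmod (G 1 - G \<eta>)"
    by (simp add: integral_unique)
  also have "\<dots> \<le> cmod (G 1) + cmod (G \<eta>)" by (rule norm_triangle_ineq4)
  also have "cmod (G x) \<le> 3 / u\<^sup>2" if x: "x \<in> {\<eta>, 1}" for x
  proof -
    have "cmod (G x) = cmod (complex_of_real (1 + \<eta> - 2 * x) / v ^ 2 + 2 / v ^ 3)"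
      using x by (auto simp: G_def norm_mult norm_minus_commute simp flip: norm_minus_cancel[of "_ + _"])
    also have "\<dots> \<le> cmod (complex_of_real (1 + \<eta> - 2 * x)) / u\<^sup>2 + 2 / \<bar>u\<bar> ^ 3"
      by (rule order_trans[OF norm_triangle_ineq]) (simp add: norm_divide norm_power v_norm)
    also have "cmod (complex_of_real (1 + \<eta> - 2 * x)) \<le> 1"
      unfolding norm_of_real using x assms by auto
    also have "2 / \<bar>u\<bar> ^ 3 \<le> 2 / u\<^sup>2"
      using assms power_increasing[of 2 3 "\<bar>u\<bar>"] by (intro divide_left_mono) auto
    finally show ?thesis using assms by (simp add: divide_right_mono)
  qed
  from this[of 1] this[of \<eta>] have "cmod (G 1) + cmod (G \<eta>) \<le> 6 / u\<^sup>2" by simp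
  finally show ?thesis by simp
qed

lemma has_integral_cis_period:
  fixes h :: real and k :: int
  assumes "h > 0" "h * (b - a) = 2 * pi"
  shows "((\<lambda>x. cis (h * of_int k * x)) has_integral (if k = 0 then of_real (b - a) else 0)) {a..b}"
proof (cases "k = 0")
  case True
  have "0 < b - a" using assms by (metis pi_gt_zero mult_pos_pos zero_less_mult_pos zero_less_numeral)
  then show ?thesis using True has_integral_const_real[of "1::complex" a b] by (simp add: scaleR_conv_of_real)
next
  case False
  define u where "u = h * of_int k"
  have u: "u \<noteq> 0" using False assms by (simp add: u_def)
  have "0 < b - a" using assms by (metis pi_gt_zero mult_pos_pos zero_less_mult_pos zero_less_numeral)
  have "((\<lambda>x. cis (u * x)) has_integral (cis (u * b) / (\<i> * of_real u) - cis (u * a) / (\<i> * of_real u))) {a..b}"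
  proof (rule fundamental_theorem_of_calculus)
    fix x
    show "((\<lambda>x. cis (u * x) / (\<i> * of_real u)) has_vector_derivative cis (u * x)) (at x within {a..b})"
      using has_vector_derivative_divide[OF has_vector_derivative_cis[of u x "{a..b}"], of "\<i> * of_real u"] u
      by simp
  qed (use \<open>0 < b - a\<close> in auto)
  moreover have "cis (u * b) = cis (u * a)"
  proof -
    have "u * b = u * a + 2 * pi * of_int k"
      using arg_cong[OF assms(2), of "\<lambda>t. t * of_int k"] by (simp add: u_def algebra_simps)
    then show ?thesis by (simp add: cis_mult[symmetric] del: cis_mult)
  qed
  ultimately show ?thesis using False by (simp add: u_def)
qed

lemma has_integral_trig_poly_square:
  fixes c :: "int \<Rightarrow> complex"
  assumes "finite K" "h > 0" "h * (b - a) = 2 * pi"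
  shows "((\<lambda>x. (cmod (\<Sum>k\<in>K. c k * cis (h * of_int k * x)))\<^sup>2) has_integral
           (b - a) * (\<Sum>k\<in>K. (cmod (c k))\<^sup>2)) {a..b}"
proof -
  have eq: "complex_of_real ((cmod (\<Sum>k\<in>K. c k * cis (h * of_int k * x)))\<^sup>2)
     = (\<Sum>k\<in>K. \<Sum>j\<in>K. c k * cnj (c j) * cis (h * of_int (k - j) * x))" for x
  proof -
    have "cis (h * of_int (k - j) * x) = cis (h * of_int k * x) * cnj (cis (h * of_int j * x))" for k j :: int
      by (simp add: cis_cnj cis_mult left_diff_distrib right_diff_distrib)
    then show ?thesis
      unfolding complex_norm_square cnj_sum sum_product complex_cnj_mult
      by (intro sum.cong refl) (simp only: mult_ac)
  qed
  have "((\<lambda>x. \<Sum>k\<in>K. \<Sum>j\<in>K. c k * cnj (c j) * cis (h * of_int (k - j) * x)) has_integral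
      (\<Sum>k\<in>K. \<Sum>j\<in>K. c k * cnj (c j) * (if k - j = 0 then of_real (b - a) else 0))) {a..b}"
    by (intro has_integral_sum has_integral_mult_right has_integral_cis_period assms)
  also have "(\<Sum>k\<in>K. \<Sum>j\<in>K. c k * cnj (c j) * (if k - j = 0 then of_real (b - a) else 0))
      = complex_of_real ((b - a) * (\<Sum>k\<in>K. (cmod (c k))\<^sup>2))"
    using \<open>finite K\<close>
    by (simp add: if_distrib[of "(*) _"] complex_norm_square sum_distrib_left mult_ac
        del: of_real_power cong: if_cong)
  finally have "((\<lambda>x. complex_of_real ((cmod (\<Sum>k\<in>K. c k * cis (h * of_int k * x)))\<^sup>2)) has_integral
      complex_of_real ((b - a) * (\<Sum>k\<in>K. (cmod (c k))\<^sup>2))) {a..b}"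
    unfolding eq .
  from has_integral_linear[OF this bounded_linear_Re] show ?thesis
    by (simp add: o_def)
qed

text \<open>Expanding the integral of \<open>(cmod (f x) - m)^2 >= 0\<close>, where \<open>m\<close>
  is the integral of \<open>cmod (f x)\<close>, gives the claim because the interval has length at
  most 1.\<close>

lemma integral_norm_square_le:
  fixes f :: "real \<Rightarrow> complex"
  assumes "continuous_on {a..b} f" "a \<le> b" "b - a \<le> 1"
  shows "(integral {a..b} (\<lambda>x. cmod (f x)))\<^sup>2 \<le> integral {a..b} (\<lambda>x. (cmod (f x))\<^sup>2)"
proof -
  define m where "m = integral {a..b} (\<lambda>x. cmod (f x))"
  have i1: "((\<lambda>x. cmod (f x)) has_integral m) {a..b}"
    unfolding m_def using assms by (intro integrable_integral integrable_continuous_interval continuous_intros)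
  have i2: "((\<lambda>x. (cmod (f x))\<^sup>2) has_integral integral {a..b} (\<lambda>x. (cmod (f x))\<^sup>2)) {a..b}"
    using assms by (intro integrable_integral integrable_continuous_interval continuous_intros)
  have "((\<lambda>x. (cmod (f x))\<^sup>2 - 2 * m * cmod (f x) + m\<^sup>2) has_integral
     (integral {a..b} (\<lambda>x. (cmod (f x))\<^sup>2) - 2 * m * m + (b - a) * m\<^sup>2)) {a..b}"
    using has_integral_add[OF has_integral_diff[OF i2 has_integral_mult_right[OF i1, of "2 * m"]]
        has_integral_const_real[of "m\<^sup>2" a b]] assms
    by simp
  then have "0 \<le> integral {a..b} (\<lambda>x. (cmod (f x))\<^sup>2) - 2 * m * m + (b - a) * m\<^sup>2"
  proof (rule has_integral_nonneg)
    fix x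
    have "(cmod (f x))\<^sup>2 - 2 * m * cmod (f x) + m\<^sup>2 = (cmod (f x) - m)\<^sup>2"
      by (simp add: power2_diff algebra_simps)
    then show "0 \<le> (cmod (f x))\<^sup>2 - 2 * m * cmod (f x) + m\<^sup>2" by simp
  qed
  moreover have "(b - a) * m\<^sup>2 \<le> 1 * m\<^sup>2" using assms by (intro mult_right_mono) auto
  ultimately show ?thesis unfolding m_def[symmetric] by (simp add: power2_eq_square)
qed

section \<open>Trial functions: their norms and Fourier-Bessel coefficients\<close>

text \<open>The truncation by \<open>max 0\<close> extends the quadratic continuously by zero, so
  that a trial function lives on the whole line but is supported in [\<eta>,1].\<close>

definition window :: "real \<Rightarrow> real \<Rightarrow> real" where
  "window \<eta> x = max 0 ((x - \<eta>) * (1 - x))"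

definition trial :: "real \<Rightarrow> real \<Rightarrow> int set \<Rightarrow> (int \<Rightarrow> complex) \<Rightarrow> real \<Rightarrow> complex" where
  "trial \<eta> h K c x = of_real (window \<eta> x) * (\<Sum>k\<in>K. c k * cis (h * of_int k * x))"

lemma window_eq: "\<eta> \<le> x \<Longrightarrow> x \<le> 1 \<Longrightarrow> window \<eta> x = (x - \<eta>) * (1 - x)"
  by (simp add: window_def)

lemma window_eq_0: "\<eta> \<le> 1 \<Longrightarrow> x < \<eta> \<Longrightarrow> window \<eta> x = 0"
  using mult_nonpos_nonneg[of "x - \<eta>" "1 - x"] by (simp add: window_def max_absorb1)

lemma continuous_on_cis_linear [continuous_intros]: "continuous_on S (\<lambda>x. cis (u * x))"
  by (intro continuous_on_cis continuous_intros)

lemma continuous_on_window [continuous_intros]: "continuous_on S (window \<eta>)"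
  unfolding window_def[abs_def] by (intro continuous_intros)

lemma continuous_on_trial [continuous_intros]: "continuous_on S (trial \<eta> h K c)"
  unfolding trial_def[abs_def] by (intro continuous_intros)

lemma trial_norm:
  assumes "0 < \<eta>" "\<eta> < 1"
  shows "trial \<eta> h K c \<in> L2_01"
    and "(LINT x|M01. (cmod (trial \<eta> h K c x))\<^sup>2) = integral {\<eta>..1} (\<lambda>x. (cmod (trial \<eta> h K c x))\<^sup>2)"
proof -
  have "integrable M01 (trial \<eta> h K c)"
    by (rule integral_M01_eq[of \<eta>]) (use assms in \<open>auto intro!: continuous_intros simp: trial_def window_eq_0\<close>)
  moreover have sq: "integrable M01 (\<lambda>x. (cmod (trial \<eta> h K c x))\<^sup>2)"
    by (rule integral_M01_eq[of \<eta>]) (use assms in \<open>auto intro!: continuous_intros simp: trial_def window_eq_0\<close>)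
  ultimately show "trial \<eta> h K c \<in> L2_01"
    by (simp add: L2_01_def)
  show "(LINT x|M01. (cmod (trial \<eta> h K c x))\<^sup>2) = integral {\<eta>..1} (\<lambda>x. (cmod (trial \<eta> h K c x))\<^sup>2)"
    by (rule integral_M01_eq[of \<eta>]) (use assms in \<open>auto intro!: continuous_intros simp: trial_def window_eq_0\<close>)
qed

text \<open>On [2\<eta>, 1-\<eta>] both factors of the window are at least \<eta>, and the interval
  is one full period of the exponentials, so Parseval's identity applies there.\<close>

lemma trial_norm_lower:
  assumes "0 < \<eta>" "\<eta> < 1/3" "finite K" "h > 0" "h * (1 - 3 * \<eta>) = 2 * pi"
  shows "\<eta> ^ 4 * (1 - 3 * \<eta>) * (\<Sum>k\<in>K. (cmod (c k))\<^sup>2)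
    \<le> integral {\<eta>..1} (\<lambda>x. (cmod (trial \<eta> h K c x))\<^sup>2)"
proof -
  define P where "P x = (\<Sum>k\<in>K. c k * cis (h * of_int k * x))" for x
  have "((\<lambda>x. (cmod (P x))\<^sup>2) has_integral (1 - \<eta> - 2 * \<eta>) * (\<Sum>k\<in>K. (cmod (c k))\<^sup>2)) {2 * \<eta>..1 - \<eta>}"
    unfolding P_def using assms by (intro has_integral_trig_poly_square) auto
  then have "((\<lambda>x. \<eta> ^ 4 * (cmod (P x))\<^sup>2) has_integral
      \<eta> ^ 4 * ((1 - \<eta> - 2 * \<eta>) * (\<Sum>k\<in>K. (cmod (c k))\<^sup>2))) {2 * \<eta>..1 - \<eta>}"
    by (rule has_integral_mult_right)
  moreover have "((\<lambda>x. (cmod (trial \<eta> h K c x))\<^sup>2) has_integral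
      integral {2 * \<eta>..1 - \<eta>} (\<lambda>x. (cmod (trial \<eta> h K c x))\<^sup>2)) {2 * \<eta>..1 - \<eta>}"
    by (intro integrable_integral integrable_continuous_interval continuous_intros)
  ultimately have "\<eta> ^ 4 * ((1 - \<eta> - 2 * \<eta>) * (\<Sum>k\<in>K. (cmod (c k))\<^sup>2))
      \<le> integral {2 * \<eta>..1 - \<eta>} (\<lambda>x. (cmod (trial \<eta> h K c x))\<^sup>2)"
  proof (rule has_integral_le)
    fix x assume x: "x \<in> {2 * \<eta>..1 - \<eta>}"
    have "\<eta> * \<eta> \<le> (x - \<eta>) * (1 - x)"
      using x assms by (intro mult_mono) auto
    then have "\<eta> * \<eta> \<le> window \<eta> x" by (simp add: window_def)
    then have "(\<eta> * \<eta>)\<^sup>2 \<le> (window \<eta> x)\<^sup>2" by (intro power_mono) auto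
    then have "\<eta> ^ 4 * (cmod (P x))\<^sup>2 \<le> (window \<eta> x)\<^sup>2 * (cmod (P x))\<^sup>2"
      by (intro mult_right_mono) (simp_all add: power_mult_distrib flip: power_add)
    then show "\<eta> ^ 4 * (cmod (P x))\<^sup>2 \<le> (cmod (trial \<eta> h K c x))\<^sup>2"
      by (simp add: trial_def P_def norm_mult power_mult_distrib)
  qed
  also have "\<dots> \<le> integral {\<eta>..1} (\<lambda>x. (cmod (trial \<eta> h K c x))\<^sup>2)"
    using assms by (intro integral_subset_le integrable_continuous_interval continuous_intros) auto
  finally show ?thesis by (simp add: mult.assoc)
qed

lemma fourier_bessel_coeff_trial:
  assumes "0 < \<eta>" "\<eta> < 1" "s > 0"
  shows "fourier_bessel_coeff \<alpha> s (trial \<eta> h K c) =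
    integral {\<eta>..1} (\<lambda>x. trial \<eta> h K c x * complex_of_real (sqrt (s * x) * bessel_J \<alpha> (s * x)))"
    and "continuous_on {\<eta>..1} (\<lambda>x. sqrt (s * x) * bessel_J \<alpha> (s * x))"
proof -
  have "(\<lambda>x. s * x) ` {\<eta>..1} \<subseteq> {0<..}"
    using assms by (auto simp del: image_mult_atLeastAtMost)
  then show cont: "continuous_on {\<eta>..1} (\<lambda>x. sqrt (s * x) * bessel_J \<alpha> (s * x))"
    by (intro continuous_on_compose2[OF sqrt_bessel_J_continuous] continuous_intros)
  have "fourier_bessel_coeff \<alpha> s (trial \<eta> h K c) =
      (LINT x|M01. trial \<eta> h K c x * complex_of_real (sqrt (s * x) * bessel_J \<alpha> (s * x)))"
    unfolding fourier_bessel_coeff_def by (intro Bochner_Integration.integral_cong) auto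
  also have "\<dots> = integral {\<eta>..1} (\<lambda>x. trial \<eta> h K c x * complex_of_real (sqrt (s * x) * bessel_J \<alpha> (s * x)))"
  proof (rule integral_M01_eq)
    show "continuous_on {\<eta>..1} (\<lambda>x. trial \<eta> h K c x * complex_of_real (sqrt (s * x) * bessel_J \<alpha> (s * x)))"
      by (intro continuous_on_mult continuous_on_of_real cont continuous_on_trial)
    show "trial \<eta> h K c x * complex_of_real (sqrt (s * x) * bessel_J \<alpha> (s * x)) = 0" if "x < \<eta>" for x
      unfolding trial_def using window_eq_0[of \<eta> x] that assms by simp
  qed (use assms in simp_all)
  finally show "fourier_bessel_coeff \<alpha> s (trial \<eta> h K c) =
    integral {\<eta>..1} (\<lambda>x. trial \<eta> h K c x * complex_of_real (sqrt (s * x) * bessel_J \<alpha> (s * x)))" .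
qed

lemma integral_trial_mult:
  assumes "finite K" "continuous_on {\<eta>..1} \<phi>"
  shows "integral {\<eta>..1} (\<lambda>x. trial \<eta> h K c x * \<phi> x) =
    (\<Sum>k\<in>K. c k * integral {\<eta>..1} (\<lambda>x. of_real (window \<eta> x) * cis (h * of_int k * x) * \<phi> x))"
proof -
  have "((\<lambda>x. \<Sum>k\<in>K. c k * (of_real (window \<eta> x) * cis (h * of_int k * x) * \<phi> x)) has_integral
    (\<Sum>k\<in>K. c k * integral {\<eta>..1} (\<lambda>x. of_real (window \<eta> x) * cis (h * of_int k * x) * \<phi> x))) {\<eta>..1}"
    using assms
    by (intro has_integral_sum has_integral_mult_right integrable_integral
        integrable_continuous_interval continuous_intros)
  also have "(\<lambda>x. \<Sum>k\<in>K. c k * (of_real (window \<eta> x) * cis (h * of_int k * x) * \<phi> x))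
      = (\<lambda>x. trial \<eta> h K c x * \<phi> x)"
    by (simp add: trial_def sum_distrib_left sum_distrib_right mult_ac)
  finally show ?thesis by (rule integral_unique)
qed

text \<open>The two exponentials of the kernel shift the frequency \<open>\<omega>\<close> to
  \<open>\<omega> + s\<close> and \<open>\<omega> - s\<close>, and each shifted frequency is covered
  by the window estimate.\<close>

lemma norm_window_oscillation_le:
  assumes "0 \<le> \<eta>" "\<eta> \<le> 1" "\<bar>\<omega> + s\<bar> \<ge> 1" "\<bar>\<omega> - s\<bar> \<ge> 1"
  shows "cmod (integral {\<eta>..1} (\<lambda>x. of_real (window \<eta> x) * cis (\<omega> * x) * (p * cis (s * x) + q * cis (- (s * x)))))
    \<le> 6 * (cmod p + cmod q) * (1 / (\<omega> + s)\<^sup>2 + 1 / (\<omega> - s)\<^sup>2)"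
proof -
  define W where "W u = integral {\<eta>..1} (\<lambda>x. complex_of_real ((x - \<eta>) * (1 - x)) * cis (u * x))" for u
  have W: "((\<lambda>x. complex_of_real ((x - \<eta>) * (1 - x)) * cis (u * x)) has_integral W u) {\<eta>..1}" for u
    unfolding W_def by (intro integrable_integral integrable_continuous_interval continuous_intros)
  have "((\<lambda>x. p * (complex_of_real ((x - \<eta>) * (1 - x)) * cis ((\<omega> + s) * x))
       + q * (complex_of_real ((x - \<eta>) * (1 - x)) * cis ((\<omega> - s) * x))) has_integral
       (p * W (\<omega> + s) + q * W (\<omega> - s))) {\<eta>..1}"
    by (intro has_integral_add has_integral_mult_right W)
  also have "?this \<longleftrightarrow> ((\<lambda>x. of_real (window \<eta> x) * cis (\<omega> * x) * (p * cis (s * x) + q * cis (- (s * x))))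
      has_integral (p * W (\<omega> + s) + q * W (\<omega> - s))) {\<eta>..1}"
  proof (rule has_integral_cong)
    fix x assume "x \<in> {\<eta>..1}"
    then have "window \<eta> x = (x - \<eta>) * (1 - x)" by (simp add: window_eq)
    moreover have "cis ((\<omega> + s) * x) = cis (\<omega> * x) * cis (s * x)"
        "cis ((\<omega> - s) * x) = cis (\<omega> * x) * cis (- (s * x))"
      by (simp_all add: cis_mult left_diff_distrib distrib_right)
    ultimately show "p * (complex_of_real ((x - \<eta>) * (1 - x)) * cis ((\<omega> + s) * x))
       + q * (complex_of_real ((x - \<eta>) * (1 - x)) * cis ((\<omega> - s) * x))
       = of_real (window \<eta> x) * cis (\<omega> * x) * (p * cis (s * x) + q * cis (- (s * x)))"
      by (simp only: distrib_left mult_ac)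
  qed
  finally have "cmod (integral {\<eta>..1} (\<lambda>x. of_real (window \<eta> x) * cis (\<omega> * x) * (p * cis (s * x) + q * cis (- (s * x)))))
      = cmod (p * W (\<omega> + s) + q * W (\<omega> - s))"
    by (simp only: integral_unique)
  also have "\<dots> \<le> cmod p * cmod (W (\<omega> + s)) + cmod q * cmod (W (\<omega> - s))"
    by (rule order_trans[OF norm_triangle_ineq]) (simp add: norm_mult)
  also have "\<dots> \<le> (cmod p + cmod q) * (6 / (\<omega> + s)\<^sup>2) + (cmod p + cmod q) * (6 / (\<omega> - s)\<^sup>2)"
    unfolding W_def using assms
    by (intro add_mono mult_mono norm_window_fourier_le) auto
  also have "\<dots> = 6 * (cmod p + cmod q) * (1 / (\<omega> + s)\<^sup>2 + 1 / (\<omega> - s)\<^sup>2)"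
    unfolding distrib_left[of _ "1 / _"] by (simp add: mult.commute)
  finally show ?thesis .
qed

text \<open>In the Schur test every row and every column consists of two inverse-square sums, each
  at most \<open>2 / (d * (M - d))\<close>; with the 6 of the window estimate this makes 24.\<close>

lemma sum_oscillation_trial_le:
  fixes t :: "'n \<Rightarrow> real"
  assumes "0 \<le> \<eta>" "\<eta> \<le> 1" "finite S" "finite K" "0 < d" "d \<le> h" "d < M" "1 \<le> M"
    and sep: "\<And>m n. m \<in> S \<Longrightarrow> n \<in> S \<Longrightarrow> m \<noteq> n \<Longrightarrow> d \<le> \<bar>t m - t n\<bar>"
    and far: "\<And>n k. n \<in> S \<Longrightarrow> k \<in> K \<Longrightarrow> M \<le> \<bar>h * of_int k + t n\<bar>"
      "\<And>n k. n \<in> S \<Longrightarrow> k \<in> K \<Longrightarrow> M \<le> \<bar>h * of_int k - t n\<bar>"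
  shows "(\<Sum>n\<in>S. (cmod (integral {\<eta>..1} (\<lambda>x. trial \<eta> h K c x * (p * cis (t n * x) + q * cis (- (t n * x))))))\<^sup>2)
    \<le> (24 * (cmod p + cmod q) / (d * (M - d)))\<^sup>2 * (\<Sum>k\<in>K. (cmod (c k))\<^sup>2)"
proof -
  define Q where "Q = 6 * (cmod p + cmod q)"
  define B where "B n k = Q * (1 / (h * of_int k + t n)\<^sup>2 + 1 / (h * of_int k - t n)\<^sup>2)" for n and k :: int
  have Q0: "Q \<ge> 0" by (simp add: Q_def)
  define r where "r = 2 / (d * (M - d))"
  have sepK: "d \<le> \<bar>h * of_int k - h * of_int j\<bar>" if "k \<noteq> j" for k j :: int
  proof -
    \<comment> \<open>Because \<open>d <= h\<close>, the frequencies \<open>h * k\<close> are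
      \<open>d\<close>-separated just as the \<open>t n\<close> are, and one bound serves rows and
      columns.\<close>
    have "h * 1 \<le> h * \<bar>of_int (k - j)\<bar>"
      using that assms by (intro mult_left_mono) linarith+
    also have "\<dots> = \<bar>h * of_int k - h * of_int j\<bar>"
      using assms by (simp add: abs_mult flip: right_diff_distrib)
    finally show ?thesis using assms by simp
  qed
  have trig: "continuous_on {\<eta>..1} (\<lambda>x. p * cis (t n * x) + q * cis (- (t n * x)))" for n
    using continuous_on_cis_linear[of _ "- t n"] by (auto intro!: continuous_intros)
  have "(\<Sum>n\<in>S. (cmod (\<Sum>k\<in>K. c k * integral {\<eta>..1} (\<lambda>x. of_real (window \<eta> x) * cis (h * of_int k * x)
        * (p * cis (t n * x) + q * cis (- (t n * x))))))\<^sup>2) \<le> (Q * (r + r))\<^sup>2 * (\<Sum>k\<in>K. (cmod (c k))\<^sup>2)"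
  proof (rule schur_test[where B = B])
    fix n k assume n: "n \<in> S" and k: "k \<in> K"
    show "cmod (integral {\<eta>..1} (\<lambda>x. of_real (window \<eta> x) * cis (h * of_int k * x)
        * (p * cis (t n * x) + q * cis (- (t n * x))))) \<le> B n k"
      unfolding B_def Q_def using far[OF n k] assms by (intro norm_window_oscillation_le) auto
  next
    fix n assume n: "n \<in> S"
    have "(\<Sum>k\<in>K. 1 / (h * of_int k - (- t n))\<^sup>2) \<le> r" "(\<Sum>k\<in>K. 1 / (h * of_int k - t n)\<^sup>2) \<le> r"
      unfolding r_def using assms n sepK far[OF n] by (intro sum_inverse_squares_separated; auto)+
    then show "(\<Sum>k\<in>K. B n k) \<le> Q * (r + r)"
      unfolding B_def sum_distrib_left[symmetric] sum.distrib
      using Q0 by (intro mult_left_mono add_mono) auto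
  next
    fix k assume k: "k \<in> K"
    have "(\<Sum>n\<in>S. 1 / (t n - (- (h * of_int k)))\<^sup>2) \<le> r" "(\<Sum>n\<in>S. 1 / (t n - h * of_int k)\<^sup>2) \<le> r"
      unfolding r_def using assms sep far[OF _ k]
      by (intro sum_inverse_squares_separated; auto simp: add.commute abs_minus_commute)+
    then show "(\<Sum>n\<in>S. B n k) \<le> Q * (r + r)"
      unfolding B_def sum_distrib_left[symmetric] sum.distrib
      using Q0 by (intro mult_left_mono add_mono) (auto simp: add.commute power2_commute)
  qed (use assms Q0 in \<open>auto simp: r_def\<close>)
  moreover have "Q * (r + r) = 24 * (cmod p + cmod q) / (d * (M - d))"
    by (simp add: Q_def r_def)
  ultimately show ?thesis
    by (simp add: integral_trial_mult[OF \<open>finite K\<close> trig])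
qed

text \<open>The kernel is split into its exponential part and a remainder, at the price of a factor
  2 in the squares. On [\<eta>,1] one has \<open>s * x >= s * \<eta> >= 1\<close>, so the remainder
  is at most \<open>C / (s * \<eta>)\<close>, and the factor \<open>1 / s^2\<close> can be summed
  over separated points.\<close>

lemma fourier_bessel_coeff_trial_le:
  assumes asymp: "\<And>z. z \<ge> 1 \<Longrightarrow>
      cmod (complex_of_real (sqrt z * bessel_J \<alpha> z) - (p * cis z + q * cis (- z))) \<le> C / z"
    and "0 < \<eta>" "\<eta> < 1" "1 \<le> s * \<eta>"
  shows "(cmod (fourier_bessel_coeff \<alpha> s (trial \<eta> h K c)))\<^sup>2 \<le>
     2 * (cmod (integral {\<eta>..1} (\<lambda>x. trial \<eta> h K c x * (p * cis (s * x) + q * cis (- (s * x))))))\<^sup>2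
     + 2 * (C / \<eta>)\<^sup>2 * (1 / s\<^sup>2) * integral {\<eta>..1} (\<lambda>x. (cmod (trial \<eta> h K c x))\<^sup>2)"
proof -
  let ?f = "trial \<eta> h K c"
  define \<phi> where "\<phi> x = p * cis (s * x) + q * cis (- (s * x))" for x
  define \<rho> where "\<rho> x = complex_of_real (sqrt (s * x) * bessel_J \<alpha> (s * x)) - \<phi> x" for x
  have s: "s > 0" using assms by (metis less_le_trans zero_less_mult_pos2 zero_less_one)
  have C0: "C \<ge> 0" using order_trans[OF norm_ge_zero asymp[of 1]] by simp
  have \<phi>: "continuous_on {\<eta>..1} \<phi>"
    unfolding \<phi>_def[abs_def] using continuous_on_cis_linear[of _ "- s"] by (auto intro!: continuous_intros)
  have \<rho>: "continuous_on {\<eta>..1} \<rho>"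
    unfolding \<rho>_def[abs_def]
    by (intro continuous_on_diff continuous_on_of_real fourier_bessel_coeff_trial(2) \<phi> assms s)
  have "fourier_bessel_coeff \<alpha> s ?f = integral {\<eta>..1} (\<lambda>x. ?f x * \<phi> x + ?f x * \<rho> x)"
    using assms s by (simp add: fourier_bessel_coeff_trial(1) \<rho>_def algebra_simps)
  also have "\<dots> = integral {\<eta>..1} (\<lambda>x. ?f x * \<phi> x) + integral {\<eta>..1} (\<lambda>x. ?f x * \<rho> x)"
    by (intro integral_add integrable_continuous_interval continuous_intros \<phi> \<rho>)
  finally have split: "fourier_bessel_coeff \<alpha> s ?f =
      integral {\<eta>..1} (\<lambda>x. ?f x * \<phi> x) + integral {\<eta>..1} (\<lambda>x. ?f x * \<rho> x)" .
  have "cmod (integral {\<eta>..1} (\<lambda>x. ?f x * \<rho> x)) \<le> integral {\<eta>..1} (\<lambda>x. C / (s * \<eta>) * cmod (?f x))"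
  proof (rule integral_norm_bound_integral)
    fix x assume x: "x \<in> {\<eta>..1}"
    have "s * \<eta> \<le> s * x" using x s by simp
    moreover have "cmod (\<rho> x) \<le> C / (s * x)"
      unfolding \<rho>_def \<phi>_def using assms calculation by (intro asymp) simp
    moreover have "C / (s * x) \<le> C / (s * \<eta>)"
      using C0 s assms calculation x by (intro divide_left_mono) auto
    ultimately have "cmod (\<rho> x) \<le> C / (s * \<eta>)" by simp
    then show "cmod (?f x * \<rho> x) \<le> C / (s * \<eta>) * cmod (?f x)"
      by (metis mult.commute mult_right_mono norm_ge_zero norm_mult)
  qed (intro integrable_continuous_interval continuous_intros \<rho>)+
  also have "\<dots> = C / (s * \<eta>) * integral {\<eta>..1} (\<lambda>x. cmod (?f x))"
    by simp
  finally have "(cmod (integral {\<eta>..1} (\<lambda>x. ?f x * \<rho> x)))\<^sup>2 \<le> (C / (s * \<eta>) * integral {\<eta>..1} (\<lambda>x. cmod (?f x)))\<^sup>2"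
    by (intro power_mono) auto
  also have "\<dots> = (C / (s * \<eta>))\<^sup>2 * (integral {\<eta>..1} (\<lambda>x. cmod (?f x)))\<^sup>2"
    by (rule power_mult_distrib)
  also have "\<dots> \<le> (C / (s * \<eta>))\<^sup>2 * integral {\<eta>..1} (\<lambda>x. (cmod (?f x))\<^sup>2)"
    using assms by (intro mult_left_mono integral_norm_square_le continuous_intros) auto
  also have "(C / (s * \<eta>))\<^sup>2 = (C / \<eta>)\<^sup>2 * (1 / s\<^sup>2)"
    by (simp add: power_divide power_mult_distrib)
  finally have rem: "(cmod (integral {\<eta>..1} (\<lambda>x. ?f x * \<rho> x)))\<^sup>2 \<le>
      (C / \<eta>)\<^sup>2 * (1 / s\<^sup>2) * integral {\<eta>..1} (\<lambda>x. (cmod (?f x))\<^sup>2)" .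
  have "(cmod (u + v))\<^sup>2 \<le> 2 * (cmod u)\<^sup>2 + 2 * (cmod v)\<^sup>2" for u v :: complex
  proof -
    have "(cmod (u + v))\<^sup>2 \<le> (cmod u + cmod v)\<^sup>2"
      by (intro power_mono norm_triangle_ineq) auto
    also have "\<dots> \<le> 2 * (cmod u)\<^sup>2 + 2 * (cmod v)\<^sup>2"
      using sum_squares_bound[of "cmod u" "cmod v"] by (simp add: power2_sum)
    finally show ?thesis .
  qed
  from order_trans[OF this[of "integral {\<eta>..1} (\<lambda>x. ?f x * \<phi> x)" "integral {\<eta>..1} (\<lambda>x. ?f x * \<rho> x)"]] rem
  show ?thesis unfolding split \<phi>_def[symmetric] by (simp add: mult.assoc)
qed

section \<open>The density bound\<close>

text \<open>The constant \<open>C\<close> may depend on \<eta>, on the frame and on the separation,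
  but not on \<open>a\<close> or \<open>r\<close>; so the bound survives the infimum over
  \<open>a\<close>.\<close>

lemma n_points_lower_bound:
  fixes t :: "nat \<Rightarrow> real"
  assumes pos: "\<And>n. t n > 0" and inj: "inj t" and sep: "separated (range t)"
    and frame: "fourier_bessel_frame \<alpha> t"
    and \<eta>: "0 < \<eta>" "\<eta> < 1/3"
  obtains C where "\<And>a r. a \<ge> 0 \<Longrightarrow> (1 - 3 * \<eta>) / pi * r - C \<le> real (n_points (range t) a r)"
proof -
  obtain d0 where d0: "d0 > 0" "\<And>x y. x \<in> range t \<Longrightarrow> y \<in> range t \<Longrightarrow> x \<noteq> y \<Longrightarrow> dist x y > d0"
    using sep unfolding separated_def by blast
  \<comment> \<open>The minimum with 1 ensures \<open>d <= h\<close>, since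
    \<open>h >= 1\<close>.\<close>
  define d where "d = min d0 1"
  have d: "0 < d" "d \<le> 1" using d0 by (auto simp: d_def)
  have sep_t: "d \<le> \<bar>t i - t j\<bar>" if "i \<noteq> j" for i j
    using d0(2)[of "t i" "t j"] that inj by (auto simp: d_def dist_real_def inj_eq)
  from frame obtain A B where A: "A > 0" and AB: "\<forall>f\<in>L2_01.
        summable (\<lambda>n. (cmod (fourier_bessel_coeff \<alpha> (t n) f))\<^sup>2) \<and>
        A * (LINT x|M01. (cmod (f x))\<^sup>2)
          \<le> (\<Sum>n. (cmod (fourier_bessel_coeff \<alpha> (t n) f))\<^sup>2) \<and>
        (\<Sum>n. (cmod (fourier_bessel_coeff \<alpha> (t n) f))\<^sup>2)
          \<le> B * (LINT x|M01. (cmod (f x))\<^sup>2)"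
    unfolding fourier_bessel_frame_def by (elim exE conjE) (rule that)
  note summ = conjunct1[OF bspec[OF AB]]
    and lower = conjunct1[OF conjunct2[OF bspec[OF AB]]]
  obtain p q E where asymp: "\<And>z. z \<ge> 1 \<Longrightarrow>
      cmod (complex_of_real (sqrt z * bessel_J \<alpha> z) - (p * cis z + q * cis (- z))) \<le> E / z"
    by (rule sqrt_bessel_J_asymptotics[of \<alpha>]) blast
  define l where "l = 1 - 3 * \<eta>"
  define h where "h = 2 * pi / l"
  have l: "0 < l" "l < 1" using \<eta> by (auto simp: l_def)
  have hl: "h * l = 2 * pi" using l by (simp add: h_def)
  have "1 * l \<le> h * l" unfolding hl using l pi_gt3 by linarith
  then have h: "h \<ge> 1" using l by simp
  \<comment> \<open>Chosen so that \<open>2 * \<rho>^2\<close> is A/4 times the constant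
    \<open>\<eta> ^ 4 * l\<close> of the lower norm bound; this is the share of the oscillating
    part.\<close>
  define \<rho> where "\<rho> = sqrt (A * (\<eta> ^ 4 * l) / 8)"
  have \<rho>: "\<rho> > 0" using A l \<eta> by (simp add: \<rho>_def)
  define Q where "Q = 24 * (cmod p + cmod q)"
  \<comment> \<open>The last summand brings the Schur constant \<open>Q / (d * (M - d))\<close> down
    to \<open>\<rho>\<close>; the first two give \<open>M > d\<close> and
    \<open>M >= 1\<close>.\<close>
  define M where "M = d + 1 + Q / (d * \<rho>)"
  have Q0: "Q \<ge> 0" by (simp add: Q_def)
  have M: "M \<ge> d + 1" using Q0 d \<rho> by (simp add: M_def)
  have R: "Q / (d * (M - d)) \<le> \<rho>"
  proof -
    have "Q / (d * \<rho>) \<le> M - d" by (simp add: M_def)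
    then have "Q \<le> (M - d) * (d * \<rho>)" using d \<rho> by (simp only: pos_divide_le_eq mult_pos_pos)
    then have "Q \<le> \<rho> * (d * (M - d))" by (simp only: mult_ac)
    then show ?thesis using d M by (simp only: pos_divide_le_eq mult_pos_pos)
  qed
  have R0: "0 \<le> Q / (d * (M - d))" using Q0 d M by simp
  \<comment> \<open>The term \<open>1 / \<eta>\<close> gives \<open>t n * \<eta> >= 1\<close> beyond
    \<open>T\<close>, as the asymptotics require; the last term brings the total remainder down to
    A/4, as \<open>TE\<close> shows.\<close>
  define T where "T = d + 1 / \<eta> + 16 * (E / \<eta>)\<^sup>2 / (d * A)"
  have T: "T \<ge> d + 1 / \<eta>" using d A by (simp add: T_def)
  then have Td: "T > d" using \<eta> by (smt (verit) divide_pos_pos)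
  have TE: "2 * (E / \<eta>)\<^sup>2 * (2 / (d * (T - d))) \<le> A / 4"
  proof -
    have "16 * (E / \<eta>)\<^sup>2 / (d * A) \<le> T - d" using \<eta> by (simp add: T_def)
    then have "16 * (E / \<eta>)\<^sup>2 \<le> (T - d) * (d * A)"
      using d A by (simp only: pos_divide_le_eq mult_pos_pos)
    then have "4 * (E / \<eta>)\<^sup>2 \<le> A / 4 * (d * (T - d))"
    proof -
      have "(T - d) * (d * A) = 4 * (A / 4 * (d * (T - d)))" by simp
      then show ?thesis using \<open>16 * (E / \<eta>)\<^sup>2 \<le> (T - d) * (d * A)\<close> by linarith
    qed
    then have "4 * (E / \<eta>)\<^sup>2 / (d * (T - d)) \<le> A / 4"
      using d Td by (simp only: pos_divide_le_eq mult_pos_pos diff_gt_0_iff_gt)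
    then show ?thesis by simp
  qed
  define N where "N = card {n. t n \<in> {0..T}}"
  \<comment> \<open>The first two terms are the loss in counting frequencies when both ends of the
    window shrink by \<open>M\<close>; \<open>N\<close> counts the points up to
    \<open>T\<close>.\<close>
  define C where "C = 2 * M * l / pi + 2 + real N"
  have "l / pi * r - C \<le> real (n_points (range t) a r)" if a: "a \<ge> 0" for a r
  proof (rule ccontr)
    assume "\<not> l / pi * r - C \<le> real (n_points (range t) a r)"
    then have few: "real N + real (n_points (range t) a r) < l / pi * r - 2 * M * l / pi - 2"
      by (simp add: C_def)
    define K where "K = {k::int. a + M \<le> h * \<bar>real_of_int k\<bar> \<and> h * \<bar>real_of_int k\<bar> \<le> a + r - M}"
    have K: "finite K" "real (card K) \<ge> 2 * ((a + r - M - (a + M)) / h - 1)"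
      unfolding K_def using a M d h by (intro card_symmetric_int_window; simp)+
    have "2 * ((a + r - M - (a + M)) / h - 1) = l / pi * r - 2 * M * l / pi - 2"
    proof -
      have "x / h = x * l / (2 * pi)" for x by (simp add: h_def)
      then show ?thesis by (simp add: diff_divide_distrib left_diff_distrib right_diff_distrib mult_ac)
    qed
    then have "real N + real (n_points (range t) a r) < real (card K)"
      using few K(2) by linarith
    then have cK: "N + n_points (range t) a r < card K" by linarith
    \<comment> \<open>The coefficients at these points are not estimated but made to vanish exactly,
      one linear equation for \<open>c\<close> each. Points lying in both sets only reduce the
      number of equations.\<close>
    define J where "J = {n. t n \<in> {0..T}} \<union> {n. t n \<in> {a..a + r}}"
    have fin: "finite {n. t n \<in> {x..y}}" for x y
      by (rule finite_separated_bounded[OF d(1) sep_t])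
    have finJ: "finite J" unfolding J_def using fin by simp
    have "card {n. t n \<in> {a..a + r}} = n_points (range t) a r"
    proof -
      have "t ` {n. t n \<in> {a..a + r}} = range t \<inter> {a..a + r}" by auto
      then show ?thesis
        unfolding n_points_def by (metis card_image inj inj_on_subset subset_UNIV)
    qed
    then have "card J < card K"
      using cK card_Un_le[of "{n. t n \<in> {0..T}}" "{n. t n \<in> {a..a + r}}"] by (simp add: J_def N_def)
    define b where "b n k = integral {\<eta>..1} (\<lambda>x. of_real (window \<eta> x) * cis (h * of_int k * x)
        * complex_of_real (sqrt (t n * x) * bessel_J \<alpha> (t n * x)))" for n and k :: int
    obtain c where c: "\<exists>k\<in>K. c k \<noteq> 0" "\<And>n. n \<in> J \<Longrightarrow> (\<Sum>k\<in>K. b n k * c k) = 0"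
      using exists_nonzero_kernel[OF finJ K(1) \<open>card J < card K\<close>, of b] by blast
    define f where "f = trial \<eta> h K c"
    define V where "V = integral {\<eta>..1} (\<lambda>x. (cmod (f x))\<^sup>2)"
    have \<eta>1: "\<eta> < 1" using \<eta> by simp
    have f: "f \<in> L2_01" "(LINT x|M01. (cmod (f x))\<^sup>2) = V"
      unfolding f_def V_def using trial_norm[OF \<eta>(1) \<eta>1] by auto
    have zero: "fourier_bessel_coeff \<alpha> (t n) f = 0" if "n \<in> J" for n
    proof -
      have "continuous_on {\<eta>..1} (\<lambda>x. complex_of_real (sqrt (t n * x) * bessel_J \<alpha> (t n * x)))"
        by (intro continuous_on_of_real fourier_bessel_coeff_trial(2)[OF \<eta>(1) \<eta>1 pos])
      then have "fourier_bessel_coeff \<alpha> (t n) f = (\<Sum>k\<in>K. c k * b n k)"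
        unfolding f_def fourier_bessel_coeff_trial(1)[OF \<eta>(1) \<eta>1 pos] b_def
        by (rule integral_trial_mult[OF K(1)])
      also have "\<dots> = 0" using c(2)[OF that] by (simp add: mult.commute)
      finally show ?thesis .
    qed
    define c2 where "c2 = (\<Sum>k\<in>K. (cmod (c k))\<^sup>2)"
    have "c2 > 0" unfolding c2_def using c(1) K(1)
      by (metis (no_types, lifting) norm_eq_zero sum_pos2 zero_le_power2 zero_less_power2)
    have V: "\<eta> ^ 4 * l * c2 \<le> V"
      unfolding V_def f_def c2_def l_def using \<eta> K(1) h hl
      by (intro trial_norm_lower) (auto simp: l_def)
    have "0 < \<eta> ^ 4 * l * c2" using \<eta> l \<open>c2 > 0\<close> by simp
    with V have "V > 0" by linarith
    \<comment> \<open>As \<open>t n > 0\<close>, both distances are at least the distance from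
      \<open>\<bar>h * k\<bar>\<close> to \<open>t n\<close>, whatever the sign of
      \<open>k\<close>.\<close>
    have far: "M \<le> \<bar>h * of_int k + t n\<bar>" "M \<le> \<bar>h * of_int k - t n\<bar>" if "n \<notin> J" "k \<in> K" for n k
    proof -
      have "h * \<bar>real_of_int k\<bar> = \<bar>h * of_int k\<bar>" using h by (simp add: abs_mult)
      then have "a + M \<le> \<bar>h * of_int k\<bar>" "\<bar>h * of_int k\<bar> \<le> a + r - M"
        using that(2) by (auto simp: K_def)
      moreover have "t n < a \<or> t n > a + r" using that(1) by (auto simp: J_def)
      ultimately show "M \<le> \<bar>h * of_int k + t n\<bar>" "M \<le> \<bar>h * of_int k - t n\<bar>"
        using pos[of n] a by linarith+
    qed
    have bound: "(\<Sum>n\<in>S. (cmod (fourier_bessel_coeff \<alpha> (t n) f))\<^sup>2) \<le> A / 2 * V" if "finite S" for S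
    proof -
      define S' where "S' = S - J"
      define m where "m n = (cmod (integral {\<eta>..1} (\<lambda>x. f x * (p * cis (t n * x) + q * cis (- (t n * x))))))\<^sup>2" for n
      have S': "finite S'" using that by (simp add: S'_def)
      have big: "t n > T" if "n \<in> S'" for n
        using that pos[of n] by (auto simp: S'_def J_def)
      have "(\<Sum>n\<in>S. (cmod (fourier_bessel_coeff \<alpha> (t n) f))\<^sup>2)
          = (\<Sum>n\<in>S'. (cmod (fourier_bessel_coeff \<alpha> (t n) f))\<^sup>2)"
        using that zero by (intro sum.mono_neutral_right) (auto simp: S'_def)
      also have "\<dots> \<le> (\<Sum>n\<in>S'. 2 * m n + 2 * (E / \<eta>)\<^sup>2 * (1 / (t n)\<^sup>2) * V)"
      proof (rule sum_mono)
        fix n assume "n \<in> S'"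
        then have "1 / \<eta> \<le> t n" using big[of n] T d by linarith
        then have "1 \<le> t n * \<eta>" using \<eta> by (simp only: pos_divide_le_eq)
        from fourier_bessel_coeff_trial_le[OF asymp \<eta>(1) \<eta>1 this]
        show "(cmod (fourier_bessel_coeff \<alpha> (t n) f))\<^sup>2 \<le> 2 * m n + 2 * (E / \<eta>)\<^sup>2 * (1 / (t n)\<^sup>2) * V"
          unfolding m_def V_def f_def .
      qed
      also have "\<dots> = 2 * (\<Sum>n\<in>S'. m n) + 2 * (E / \<eta>)\<^sup>2 * (\<Sum>n\<in>S'. 1 / (t n)\<^sup>2) * V"
        by (simp add: sum.distrib sum_distrib_left sum_distrib_right)
      also have "\<dots> \<le> 2 * (\<rho>\<^sup>2 * c2) + A / 4 * V"
      proof (intro add_mono mult_left_mono)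
        have "(\<Sum>n\<in>S'. m n) \<le> (Q / (d * (M - d)))\<^sup>2 * c2"
          unfolding m_def f_def Q_def c2_def using \<eta> S' K(1) d h M far sep_t
          by (intro sum_oscillation_trial_le) (auto simp: S'_def)
        also have "\<dots> \<le> \<rho>\<^sup>2 * c2"
          using R R0 \<open>c2 > 0\<close> by (intro mult_right_mono power_mono) auto
        finally show "(\<Sum>n\<in>S'. m n) \<le> \<rho>\<^sup>2 * c2" .
        have "\<forall>n\<in>S'. T \<le> \<bar>t n - 0\<bar>" using big pos by (simp add: less_imp_le)
        then have "(\<Sum>n\<in>S'. 1 / (t n - 0)\<^sup>2) \<le> 2 / (d * (T - d))"
          using S' d Td sep_t by (intro sum_inverse_squares_separated) auto
        then have "2 * (E / \<eta>)\<^sup>2 * (\<Sum>n\<in>S'. 1 / (t n)\<^sup>2) \<le> 2 * (E / \<eta>)\<^sup>2 * (2 / (d * (T - d)))"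
          by (intro mult_left_mono) auto
        also note TE
        finally show "2 * (E / \<eta>)\<^sup>2 * (\<Sum>n\<in>S'. 1 / (t n)\<^sup>2) * V \<le> A / 4 * V"
          using \<open>V > 0\<close> by (intro mult_right_mono) auto
      qed auto
      also have "2 * (\<rho>\<^sup>2 * c2) = A / 4 * (\<eta> ^ 4 * l * c2)"
        using A \<eta> l by (simp add: \<rho>_def)
      also have "\<dots> \<le> A / 4 * V" using V A by (intro mult_left_mono) auto
      finally show ?thesis by simp
    qed
    \<comment> \<open>\<open>bound\<close> holds for every finite set of indices with the same right
      side, hence for the whole series.\<close>
    have "A * V \<le> A / 2 * V"
      using lower[OF f(1)] suminf_le_const[OF summ[OF f(1)] bound] by (simp add: f(2))
    then show False using A \<open>V > 0\<close> by simp
  qed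
  then show ?thesis by (intro that[of C]) (simp add: l_def)
qed

theorem mainTheorem3:
  fixes \<alpha> :: real and t :: "nat \<Rightarrow> real"
  assumes "\<alpha> > -1/2"
    and "\<And>n. t n > 0"
    and "inj t"
    and "separated (range t)"
    and "fourier_bessel_frame \<alpha> t"
  shows "lower_density (range t) \<ge> ereal (1 / pi)"
proof (rule dense_le)
  fix y :: ereal assume y: "y < ereal (1 / pi)"
  show "y \<le> lower_density (range t)"
  proof (cases y)
    case (real c)
    then have "c * pi < 1" using y by (simp add: field_simps)
    \<comment> \<open>The second entry gives \<open>3 * \<eta> <= (1 - c * pi) / 2\<close>, so that
      \<open>1 - 3 * \<eta>\<close> still exceeds \<open>c * pi\<close>; the first keeps \<eta>
      below 1/3 when \<open>c\<close> is very negative.\<close>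
    define \<eta> where "\<eta> = min (1/6) ((1 - c * pi) / 6)"
    have \<eta>: "0 < \<eta>" "\<eta> < 1/3" "6 * \<eta> \<le> 1 - c * pi"
      using \<open>c * pi < 1\<close> by (auto simp: \<eta>_def min_def)
    obtain C where C: "\<And>a r. a \<ge> 0 \<Longrightarrow> (1 - 3 * \<eta>) / pi * r - C \<le> real (n_points (range t) a r)"
      by (rule n_points_lower_bound[OF assms(2-5) \<eta>(1,2)]) blast
    have "c * pi < 1 - 3 * \<eta>" using \<eta> by linarith
    then have gap: "(1 - 3 * \<eta>) / pi - c > 0" by (simp add: field_simps)
    \<comment> \<open>Beyond this threshold the surplus slope times \<open>r\<close> absorbs
      \<open>C\<close>; the entry 1 keeps \<open>r\<close> positive for the division.\<close>
    have "\<forall>\<^sub>F r in at_top. y \<le> (INF a\<in>{0..}. ereal (real (n_points (range t) a r) / r))"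
      using eventually_ge_at_top[of "max 1 (C / ((1 - 3 * \<eta>) / pi - c))"]
    proof eventually_elim
      case (elim r)
      then have "C \<le> ((1 - 3 * \<eta>) / pi - c) * r"
        using gap by (simp add: pos_divide_le_eq mult.commute)
      then have "c * r \<le> real (n_points (range t) a r)" if "a \<ge> 0" for a
        using C[OF that, of r] by (simp add: left_diff_distrib)
      then show ?case
        unfolding real using elim by (intro INF_greatest) (simp add: pos_le_divide_eq)
    qed
    then show ?thesis
      unfolding lower_density_def by (rule Liminf_bounded)
  qed (use y in auto)
qed

end
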